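(* Let $A=(a_{ij})$ be an $n\times n$ Cartan matrix in which all order 2 principal sub-matrices have the same type. Let $P_n$ be the Poincaré series of $A$, and let $P_2$ denote the Poincaré series of the order 2 principal sub-matrix (the same for all of them). Then $$P_n=\frac{(1+t)P_2}{\frac{(n-1)(n-2)}{2}\,tP_2-\frac{(n+1)(n-2)}{2}\,P_2+\frac{n(n-1)}{2}(1+t)} .$$
   Context: A Cartan matrix is an $n\times n$ integer matrix $A=(a_{ij})$ with $a_{ii}=2$ for all $i$, $a_{ij}\le 0$ for $i\ne j$, and $a_{ij}=0\Rightarrow a_{ji}=0$. Its Weyl group is the Coxeter group $W(A)=\langle \sigma_1,\dots,\sigma_n \mid \sigma_i^2=1,\ (\sigma_i\sigma_j)^{m_{ij}}=1\ (i\ne j)\rangle$, where for $i\neq j$ one puts $m_{ij}=2,3,4,6,\infty$ according as $a_{ij}a_{ji}=0,1,2,3,\ge 4$ respectively (no relation if $m_{ij}=\infty$). Let $l(w)$ be the length of $w\in W(A)$, i.e. the least $k$ such that $w$ is a product of $k$ of the generators $\sigma_1,\dots,\sigma_n$. The Poincaré series of $A$ (equivalently of the associated Kac-Moody Lie algebra $g(A)$) is $P(A)=\sum_{w\in W(A)}t^{l(w)}$. For $I\subset\{1,\dots,n\}$, the principal sub-matrix $A_I=(a_{ij})_{i,j\in I}$ is again a Cartan matrix; its order is $|I|$. The order 2 principal sub-matrices have the same type when the products $a_{ij}a_{ji}$, $i\neq j$, all fall in the same one of the classes $0$, $1$, $2$, $3$, $\ge 4$.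
   Formalization: For n ≥ 3 the formal statement additionally assumes that all products a_ij a_ji (i ≠ j) are nonzero; when they are all 0 the formula fails, e.g. for A = 2·Id, n = 3, where P_3 = (1+t)^3 takes the value 8 at t = 1 but the right-hand side gives 4. *)

theory Defs
  imports
    "HOL-Algebra.Group"
    "HOL-Library.Extended_Nat"
    "HOL-Computational_Algebra.Formal_Power_Series"
begin

section \<open>Groups given by generators and relations\<close>

text \<open>
  The letter \<open>(s, True)\<close> stands for the generator \<open>s\<close> and \<open>(s, False)\<close> for its formal inverse.
\<close>

type_synonym 'a signed_word = "('a \<times> bool) list"

definition signed_words :: "'a set \<Rightarrow> 'a signed_word set" where
  "signed_words S = lists (S \<times> UNIV)"

inductive pres_eq :: "'a set \<Rightarrow> 'a signed_word set \<Rightarrow> 'a signed_word \<Rightarrow> 'a signed_word \<Rightarrow> bool"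
  for S :: "'a set" and R :: "'a signed_word set" where
  refl: "u \<in> signed_words S \<Longrightarrow> pres_eq S R u u"
| sym: "pres_eq S R u v \<Longrightarrow> pres_eq S R v u"
| trans: "pres_eq S R u v \<Longrightarrow> pres_eq S R v w \<Longrightarrow> pres_eq S R u w"
| cancel: "u \<in> signed_words S \<Longrightarrow> v \<in> signed_words S \<Longrightarrow> s \<in> S \<Longrightarrow>
    pres_eq S R (u @ [(s, b), (s, \<not> b)] @ v) (u @ v)"
| relator: "u \<in> signed_words S \<Longrightarrow> v \<in> signed_words S \<Longrightarrow> r \<in> R \<Longrightarrow> r \<in> signed_words S \<Longrightarrow>
    pres_eq S R (u @ r @ v) (u @ v)"

definition pres_class :: "'a set \<Rightarrow> 'a signed_word set \<Rightarrow> 'a signed_word \<Rightarrow> 'a signed_word set" where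
  "pres_class S R u = {v. pres_eq S R u v}"

definition presented_group :: "'a set \<Rightarrow> 'a signed_word set \<Rightarrow> 'a signed_word set monoid" where
  "presented_group S R =
    \<lparr>carrier = pres_class S R ` signed_words S,
     monoid.mult = (\<lambda>X Y. \<Union>x\<in>X. \<Union>y\<in>Y. pres_class S R (x @ y)),
     monoid.one = pres_class S R []\<rparr>"

lemma pres_eq_words:
  "pres_eq S R u v \<Longrightarrow> u \<in> signed_words S \<and> v \<in> signed_words S"
  by (induction rule: pres_eq.induct) (auto simp: signed_words_def)

lemma pres_eq_append_left:
  "pres_eq S R u v \<Longrightarrow> w \<in> signed_words S \<Longrightarrow> pres_eq S R (w @ u) (w @ v)"
proof (induction rule: pres_eq.induct)
  case (cancel u v s b)
  then show ?case
    using pres_eq.cancel[of "w @ u" S v s R b] by (auto simp: signed_words_def)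
next
  case (relator u v r)
  then show ?case
    using pres_eq.relator[of "w @ u" S v r R] by (auto simp: signed_words_def)
next
  case (refl u)
  then show ?case by (simp add: pres_eq.refl signed_words_def)
next
  case (sym u v)
  then show ?case by (blast intro: pres_eq.sym)
next
  case (trans u v w')
  then show ?case using pres_eq.trans by blast
qed

lemma pres_eq_append_right:
  "pres_eq S R u v \<Longrightarrow> w \<in> signed_words S \<Longrightarrow> pres_eq S R (u @ w) (v @ w)"
proof (induction rule: pres_eq.induct)
  case (cancel u v s b)
  then show ?case
    using pres_eq.cancel[of u S "v @ w" s R b] by (auto simp: signed_words_def)
next
  case (relator u v r)
  then show ?case
    using pres_eq.relator[of u S "v @ w" r R] by (auto simp: signed_words_def)
next
  case (refl u)
  then show ?case by (simp add: pres_eq.refl signed_words_def)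
next
  case (sym u v)
  then show ?case by (blast intro: pres_eq.sym)
next
  case (trans u v w')
  then show ?case using pres_eq.trans by blast
qed

lemma pres_eq_append:
  "pres_eq S R u u' \<Longrightarrow> pres_eq S R v v' \<Longrightarrow> pres_eq S R (u @ v) (u' @ v')"
  by (rule pres_eq.trans[OF pres_eq_append_right pres_eq_append_left])
    (simp_all add: pres_eq_words)

lemma pres_class_eq_iff:
  assumes "u \<in> signed_words S"
  shows "pres_class S R u = pres_class S R v \<longleftrightarrow> pres_eq S R u v"
proof
  assume "pres_class S R u = pres_class S R v"
  moreover have "u \<in> pres_class S R u"
    using assms by (simp add: pres_class_def pres_eq.refl)
  ultimately have "pres_eq S R v u" by (simp add: pres_class_def)
  then show "pres_eq S R u v" by (rule pres_eq.sym)
next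
  assume uv: "pres_eq S R u v"
  have "pres_eq S R u w \<longleftrightarrow> pres_eq S R v w" for w
    using pres_eq.trans[OF uv, of w] pres_eq.trans[OF pres_eq.sym[OF uv], of w] by blast
  then show "pres_class S R u = pres_class S R v" by (simp add: pres_class_def)
qed

lemma presented_group_mult:
  assumes "u \<in> signed_words S" "v \<in> signed_words S"
  shows "pres_class S R u \<otimes>\<^bsub>presented_group S R\<^esub> pres_class S R v = pres_class S R (u @ v)"
proof -
  have "pres_class S R (x @ y) = pres_class S R (u @ v)"
    if "x \<in> pres_class S R u" "y \<in> pres_class S R v" for x y
  proof -
    have "pres_eq S R (u @ v) (x @ y)"
      using that by (simp add: pres_class_def pres_eq_append)
    then show ?thesis
      using pres_class_eq_iff[of "u @ v" S R "x @ y"] pres_eq_words by blast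
  qed
  then have "(\<Union>x\<in>pres_class S R u. \<Union>y\<in>pres_class S R v. pres_class S R (x @ y)) =
      (\<Union>x\<in>pres_class S R u. \<Union>y\<in>pres_class S R v. pres_class S R (u @ v))"
    by (intro SUP_cong) simp_all
  moreover have "pres_class S R u \<noteq> {}" "pres_class S R v \<noteq> {}"
    using assms pres_eq.refl unfolding pres_class_def by blast+
  ultimately show ?thesis
    by (simp add: presented_group_def)
qed

lemma presented_group_inverse_word:
  "u \<in> signed_words S \<Longrightarrow> pres_eq S R (map (\<lambda>(s, b). (s, \<not> b)) (rev u) @ u) []"
proof (induction u)
  case Nil
  then show ?case by (simp add: pres_eq.refl)
next
  case (Cons a u)
  obtain s b where a: "a = (s, b)" by fastforce
  let ?i = "map (\<lambda>(s, b). (s, \<not> b)) (rev u)"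
  have u: "u \<in> signed_words S" "s \<in> S"
    using Cons.prems a by (auto simp: signed_words_def)
  then have i: "?i \<in> signed_words S"
    by (auto simp: signed_words_def)
  have "pres_eq S R (?i @ [(s, \<not> b), (s, \<not> \<not> b)] @ u) (?i @ u)"
    by (rule pres_eq.cancel[OF i u])
  then show ?case
    using pres_eq.trans[OF _ Cons.IH[OF u(1)]] a by simp
qed

lemma group_presented_group: "group (presented_group S R)"
proof (rule groupI)
  let ?G = "presented_group S R"
  have nil: "[] \<in> signed_words S" by (simp add: signed_words_def)
  have app: "u @ v \<in> signed_words S" if "u \<in> signed_words S" "v \<in> signed_words S"
    for u v :: "'a signed_word" using that by (simp add: signed_words_def)
  have car: "carrier ?G = pres_class S R ` signed_words S"
    and one: "\<one>\<^bsub>?G\<^esub> = pres_class S R []" by (simp_all add: presented_group_def)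
  show "\<one>\<^bsub>?G\<^esub> \<in> carrier ?G" using nil by (simp add: car one)
  show "x \<otimes>\<^bsub>?G\<^esub> y \<in> carrier ?G" if "x \<in> carrier ?G" "y \<in> carrier ?G" for x y
    using that app by (auto simp: car presented_group_mult)
  show "x \<otimes>\<^bsub>?G\<^esub> y \<otimes>\<^bsub>?G\<^esub> z = x \<otimes>\<^bsub>?G\<^esub> (y \<otimes>\<^bsub>?G\<^esub> z)"
    if "x \<in> carrier ?G" "y \<in> carrier ?G" "z \<in> carrier ?G" for x y z
    using that app by (auto simp: car presented_group_mult)
  show "\<one>\<^bsub>?G\<^esub> \<otimes>\<^bsub>?G\<^esub> x = x" if "x \<in> carrier ?G" for x
    using that nil by (auto simp: car one presented_group_mult)
  show "\<exists>y\<in>carrier ?G. y \<otimes>\<^bsub>?G\<^esub> x = \<one>\<^bsub>?G\<^esub>" if x: "x \<in> carrier ?G" for x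
  proof -
    obtain u where u: "u \<in> signed_words S" "x = pres_class S R u"
      using x by (auto simp: car)
    let ?i = "map (\<lambda>(s, b). (s, \<not> b)) (rev u)"
    have i: "?i \<in> signed_words S" using u by (auto simp: signed_words_def)
    have "pres_class S R ?i \<otimes>\<^bsub>?G\<^esub> x = \<one>\<^bsub>?G\<^esub>"
      using presented_group_inverse_word[OF u(1)] u i app
      by (simp add: presented_group_mult one pres_class_eq_iff)
    then show ?thesis using i by (auto simp: car)
  qed
qed


section \<open>Length and growth with respect to a generating set\<close>

definition word_length :: "('g, 'b) monoid_scheme \<Rightarrow> 'g set \<Rightarrow> 'g \<Rightarrow> nat" where
  "word_length G S g =
    (LEAST k. \<exists>xs. set xs \<subseteq> S \<and> length xs = k \<and> g = foldr (monoid.mult G) xs (monoid.one G))"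

text \<open>
  The series \<open>\<Sum>w. t ^ l(w)\<close>, with terms of equal degree collected.  The coefficients are taken in
  the field of rationals so that power series with nonzero constant term can be divided by.
\<close>

definition growth_series :: "('g, 'b) monoid_scheme \<Rightarrow> 'g set \<Rightarrow> rat fps" where
  "growth_series G S = Abs_fps (\<lambda>k. of_nat (card {g \<in> carrier G. word_length G S g = k}))"


section \<open>Cartan matrices, Weyl groups, Poincare series\<close>

text \<open>
  A matrix is a function together with its finite index set; the principal sub-matrix \<open>A\<^sub>I\<close> is the
  same function with index set \<open>I\<close>.
\<close>

definition cartan_matrix :: "'i set \<Rightarrow> ('i \<Rightarrow> 'i \<Rightarrow> int) \<Rightarrow> bool" where
  "cartan_matrix I A \<longleftrightarrow> finite I \<and>
    (\<forall>i\<in>I. A i i = 2) \<and>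
    (\<forall>i\<in>I. \<forall>j\<in>I. i \<noteq> j \<longrightarrow> A i j \<le> 0) \<and>
    (\<forall>i\<in>I. \<forall>j\<in>I. A i j = 0 \<longrightarrow> A j i = 0)"

definition coxeter_exponent :: "('i \<Rightarrow> 'i \<Rightarrow> int) \<Rightarrow> 'i \<Rightarrow> 'i \<Rightarrow> enat" where
  "coxeter_exponent A i j =
    (if A i j * A j i = 0 then 2
     else if A i j * A j i = 1 then 3
     else if A i j * A j i = 2 then 4
     else if A i j * A j i = 3 then 6
     else \<infinity>)"

definition coxeter_relators :: "'i set \<Rightarrow> ('i \<Rightarrow> 'i \<Rightarrow> int) \<Rightarrow> 'i signed_word set" where
  "coxeter_relators I A =
    {[(i, True), (i, True)] | i. i \<in> I} \<union>
    {concat (replicate m [(i, True), (j, True)]) | i j m.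
       i \<in> I \<and> j \<in> I \<and> i \<noteq> j \<and> coxeter_exponent A i j = enat m}"

definition weyl_group :: "'i set \<Rightarrow> ('i \<Rightarrow> 'i \<Rightarrow> int) \<Rightarrow> 'i signed_word set monoid" where
  "weyl_group I A = presented_group I (coxeter_relators I A)"

definition weyl_generators :: "'i set \<Rightarrow> ('i \<Rightarrow> 'i \<Rightarrow> int) \<Rightarrow> 'i signed_word set set" where
  "weyl_generators I A = (\<lambda>i. pres_class I (coxeter_relators I A) [(i, True)]) ` I"

definition poincare_series :: "'i set \<Rightarrow> ('i \<Rightarrow> 'i \<Rightarrow> int) \<Rightarrow> rat fps" where
  "poincare_series I A = growth_series (weyl_group I A) (weyl_generators I A)"

definition rank2_classes :: "int set set" where
  "rank2_classes = {{0}, {1}, {2}, {3}, {4..}}"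

text \<open>
  The class \<open>{0}\<close> is admitted here.  In that case the Weyl group is a product of \<open>n\<close> groups of
  order 2 with series \<open>(1 + t) ^ n\<close>, and the closed formula for the Poincare series of a matrix
  of constant rank 2 type fails when \<open>n \<ge> 3\<close>; a theorem asserting it has to exclude this case.
\<close>

definition same_rank2_type :: "'i set \<Rightarrow> ('i \<Rightarrow> 'i \<Rightarrow> int) \<Rightarrow> bool" where
  "same_rank2_type I A \<longleftrightarrow>
    (\<exists>C\<in>rank2_classes. \<forall>i\<in>I. \<forall>j\<in>I. i \<noteq> j \<longrightarrow> A i j * A j i \<in> C)"

end

theory Submission
  imports Defs
begin

text \<open>
  Write \<open>l\<close> for the length, call a generator \<open>s\<close> with \<open>l (s w) < l w\<close> a descent of \<open>w\<close>, and let \<open>P\<close> be the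
  Poincare series of the Weyl group \<open>W\<close> with \<open>n \<ge> 3\<close> generators, any two of which have the
  same Coxeter exponent, at least 3.  The formula is inclusion-exclusion over descent sets, kept
  short by the fact that no element of \<open>W\<close> has more than two descents.

  The exchange condition holds in \<open>W\<close> (\<open>exchange_weyl_group\<close>): every reflection is crossed an even
  number of times by every defining relator, so the parity of the number of crossings depends
  only on the element that a word represents.  It has two consequences.

  First, for a set \<open>J\<close> of generators every element is uniquely a product \<open>v m\<close> with \<open>v\<close> in the parabolic
  subgroup \<open>W\<^sub>J\<close>, with \<open>m\<close> having no descent in \<open>J\<close>, and then \<open>l (v m) = l v + l m\<close>
  (\<open>parabolic_factorization\<close>, \<open>len_parabolic_mult_minimal\<close>).  Hence the elements without descent in
  \<open>J\<close> have the series \<open>P / P\<^sub>J\<close>, where \<open>P\<^sub>J\<close> is the series of \<open>W\<^sub>J\<close>.  It equals \<open>1 + t\<close> for one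
  generator.  For two generators it is the Poincare series of the order 2 principal sub-matrix
  (\<open>poincare_series_eq_parabolic_length_series\<close>): equal exponents allow the generators outside \<open>J\<close> to
  be collapsed to one inside, which retracts \<open>W\<close> onto \<open>W\<^sub>J\<close> without increasing lengths.

  Second, three descents are impossible (\<open>card_descents_le_2\<close>).  Distinct generators do not commute,
  as the rank 2 reflection representation shows, so an element with descents \<open>x\<close> and \<open>y\<close> has a reduced
  word starting with \<open>x y x\<close>.  Starting from descents \<open>x\<close>, \<open>y\<close>, \<open>z\<close> one could strip \<open>x\<close>, \<open>y\<close>, \<open>z\<close>, \<open>x\<close>, \<open>\<dots>\<close>
  forever, each time shortening the element.

  For an element with \<open>d \<le> 2\<close> descents, the number
  \<open>((n - 1) choose 2) - (n - 2) (n - d) + ((n - d) choose 2)\<close> is \<open>1\<close> if \<open>d = 0\<close> and \<open>0\<close> otherwise, and only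
  the neutral element has \<open>d = 0\<close>.  Here \<open>n - d\<close> counts the generators that are not descents, and
  \<open>(n - d) choose 2\<close> the pairs of such generators.  Summing over \<open>W\<close> with weight \<open>t\<close> to the length gives
  \<open>1 = ((n - 1) choose 2) P - (n - 2) n P / (1 + t) + (n choose 2) P / P\<^sub>2\<close>, which is the claim solved
  for \<open>P\<close>.  For \<open>n = 2\<close> the denominator in the theorem is \<open>1 + t\<close> and both series agree.
\<close>

section \<open>Words in involutive generators\<close>

definition word_value :: "('g, 'b) monoid_scheme \<Rightarrow> 'g list \<Rightarrow> 'g" where
  "word_value G xs = foldr (monoid.mult G) xs (monoid.one G)"

lemma word_value_Nil [simp]: "word_value G [] = \<one>\<^bsub>G\<^esub>"
  and word_value_Cons [simp]: "word_value G (x # xs) = x \<otimes>\<^bsub>G\<^esub> word_value G xs"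
  by (simp_all add: word_value_def)

lemma word_length_le: "xs \<in> lists J \<Longrightarrow> word_length G J (word_value G xs) \<le> length xs"
  unfolding word_length_def word_value_def by (rule Least_le) auto

lemma word_length_witness:
  assumes "g \<in> word_value G ` lists J"
  obtains xs where "xs \<in> lists J" "length xs = word_length G J g" "word_value G xs = g"
proof -
  let ?P = "\<lambda>k. \<exists>xs. set xs \<subseteq> J \<and> length xs = k \<and> g = foldr (monoid.mult G) xs (monoid.one G)"
  have "\<exists>k. ?P k" using assms by (auto simp: word_value_def)
  then have "?P (word_length G J g)"
    unfolding word_length_def by (rule LeastI_ex)
  then show ?thesis using that by (auto simp: word_value_def)
qed

locale involution_generated_group = group G for G (structure) +
  fixes S :: "'a set"
  assumes generators_closed: "S \<subseteq> carrier G"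
    and generators_involutive: "s \<in> S \<Longrightarrow> s \<otimes> s = \<one>"
    and generated: "carrier G \<subseteq> word_value G ` lists S"
begin

abbreviation ev :: "'a list \<Rightarrow> 'a" where "ev \<equiv> word_value G"
abbreviation len :: "'a \<Rightarrow> nat" where "len \<equiv> word_length G S"

lemma generator_closed [simp]: "s \<in> S \<Longrightarrow> s \<in> carrier G"
  using generators_closed by blast

lemma ev_closed [simp]: "xs \<in> lists S \<Longrightarrow> ev xs \<in> carrier G"
  by (induction xs) auto

lemma ev_append [simp]:
  "xs \<in> lists S \<Longrightarrow> ys \<in> lists S \<Longrightarrow> ev (xs @ ys) = ev xs \<otimes> ev ys"
  by (induction xs) (auto simp: m_assoc)

lemma cancel_generator [simp]: "s \<in> S \<Longrightarrow> x \<in> carrier G \<Longrightarrow> s \<otimes> (s \<otimes> x) = x"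
  by (simp add: m_assoc [symmetric] generators_involutive)

lemma inv_generator: "s \<in> S \<Longrightarrow> inv s = s"
  by (simp add: generators_involutive inv_equality)

lemma len_ev_le: "xs \<in> lists S \<Longrightarrow> len (ev xs) \<le> length xs"
  by (rule word_length_le)

lemma reduced_word:
  assumes "g \<in> carrier G"
  obtains xs where "xs \<in> lists S" "length xs = len g" "ev xs = g"
  using word_length_witness [of g G S] assms generated by blast

lemma len_one [simp]: "len \<one> = 0"
  using len_ev_le [of "[]"] by simp

lemma len_eq_0_iff: "g \<in> carrier G \<Longrightarrow> len g = 0 \<longleftrightarrow> g = \<one>"
  by (metis len_one length_0_conv reduced_word word_value_Nil)

lemma len_generator_mult_le: "s \<in> S \<Longrightarrow> g \<in> carrier G \<Longrightarrow> len (s \<otimes> g) \<le> Suc (len g)"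
proof -
  assume *: "s \<in> S" "g \<in> carrier G"
  then obtain xs where "xs \<in> lists S" "length xs = len g" "ev xs = g"
    using reduced_word by blast
  then show ?thesis using len_ev_le [of "s # xs"] * by simp
qed

lemma len_le_generator_mult: "s \<in> S \<Longrightarrow> g \<in> carrier G \<Longrightarrow> len g \<le> Suc (len (s \<otimes> g))"
  using len_generator_mult_le [of s "s \<otimes> g"] by simp

section \<open>Counting reflections along a word\<close>

text \<open>
  A word \<open>s\<^sub>1 \<dots> s\<^sub>k\<close> crosses the reflections \<open>t\<^sub>j = s\<^sub>1 \<dots> s\<^sub>j \<dots> s\<^sub>1\<close>, one for each
  letter, and the count of \<open>t\<close> is the number of \<open>j\<close> with \<open>t\<^sub>j = t\<close>.  These are exactly the
  elements whose left multiplication deletes a letter.  For a Coxeter group, words with equal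
  value agree in the parity of each count; that is where the exchange condition comes from.
\<close>

primrec reflection_count :: "'a list \<Rightarrow> 'a \<Rightarrow> nat" where
  "reflection_count [] t = 0"
| "reflection_count (s # xs) t = of_bool (t = s) + reflection_count xs (s \<otimes> t \<otimes> s)"

lemma reflection_count_append:
  "xs \<in> lists S \<Longrightarrow> t \<in> carrier G \<Longrightarrow>
    reflection_count (xs @ ys) t =
      reflection_count xs t + reflection_count ys (inv (ev xs) \<otimes> t \<otimes> ev xs)"
  by (induction xs arbitrary: t) (auto simp: inv_mult_group inv_generator m_assoc)

lemma reflection_count_deletion:
  assumes "xs \<in> lists S" "t \<in> carrier G" "reflection_count xs t > 0"
  shows "\<exists>ys r zs. xs = ys @ r # zs \<and> t \<otimes> ev xs = ev (ys @ zs)"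
  using assms
proof (induction xs arbitrary: t rule: list.induct)
  case (Cons s xs)
  then have s: "s \<in> S" "xs \<in> lists S" by auto
  show ?case
  proof (cases "t = s")
    case True
    then have "s # xs = [] @ s # xs \<and> t \<otimes> ev (s # xs) = ev ([] @ xs)"
      using s by simp
    then show ?thesis by blast
  next
    case False
    then have "reflection_count xs (s \<otimes> t \<otimes> s) > 0" using Cons.prems by simp
    then obtain ys r zs where d: "xs = ys @ r # zs" "s \<otimes> t \<otimes> s \<otimes> ev xs = ev (ys @ zs)"
      using Cons.IH [OF s(2), of "s \<otimes> t \<otimes> s"] Cons.prems(2) s(1) by auto
    have "t \<otimes> ev (s # xs) = s \<otimes> (s \<otimes> t \<otimes> s \<otimes> ev xs)"
      using s Cons.prems(2) by (simp add: m_assoc)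
    also have "\<dots> = ev ((s # ys) @ zs)" by (simp add: d(2))
    finally have "t \<otimes> ev (s # xs) = ev ((s # ys) @ zs)" .
    moreover have "s # xs = (s # ys) @ r # zs" using d(1) by simp
    ultimately show ?thesis by blast
  qed
qed simp

text \<open>
  Compare \<open>xs\<close> with \<open>s # rs\<close>, where \<open>rs\<close> is a reduced word of \<open>s \<otimes> ev xs\<close>.  If \<open>rs\<close> crossed the
  reflection \<open>s\<close>, deleting a letter of \<open>rs\<close> would make \<open>ev xs\<close> shorter than \<open>s \<otimes> ev xs\<close>.  So
  \<open>s # rs\<close> crosses \<open>s\<close> exactly once, by parity \<open>xs\<close> crosses it too, and a letter of \<open>xs\<close> can be
  deleted.
\<close>

lemma exchange_of_reflection_parity:
  assumes parity: "\<And>xs ys t. xs \<in> lists S \<Longrightarrow> ys \<in> lists S \<Longrightarrow> ev xs = ev ys \<Longrightarrow> t \<in> S \<Longrightarrow>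
      even (reflection_count xs t) \<longleftrightarrow> even (reflection_count ys t)"
    and s: "s \<in> S" and xs: "xs \<in> lists S" and le: "len (s \<otimes> ev xs) \<le> len (ev xs)"
  shows "\<exists>ys r zs. xs = ys @ r # zs \<and> s \<otimes> ev xs = ev (ys @ zs)"
proof -
  obtain rs where rs: "rs \<in> lists S" "length rs = len (s \<otimes> ev xs)" "ev rs = s \<otimes> ev xs"
    using reduced_word [of "s \<otimes> ev xs"] s xs by auto
  have "\<not> reflection_count rs s > 0"
  proof
    assume "reflection_count rs s > 0"
    then obtain ys r zs where d: "rs = ys @ r # zs" "s \<otimes> ev rs = ev (ys @ zs)"
      using reflection_count_deletion [of rs s] rs(1) s by auto
    have "ev xs = ev (ys @ zs)" using d(2) rs(3) s xs by simp
    then have "len (ev xs) < length rs"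
      using len_ev_le [of "ys @ zs"] rs(1) d(1) by simp
    then show False using rs(2) le by simp
  qed
  then have "odd (reflection_count (s # rs) s)"
    using s by (simp add: generators_involutive)
  moreover have "ev (s # rs) = ev xs" using rs s xs by simp
  ultimately have "odd (reflection_count xs s)"
    using parity [of "s # rs" xs s] rs(1) s xs by auto
  then have "reflection_count xs s > 0" by (rule odd_pos)
  then show ?thesis using reflection_count_deletion xs s by simp
qed

text \<open>
  The palindromes \<open>s\<^sub>1 \<dots> s\<^sub>j \<dots> s\<^sub>1\<close> of an alternating word are alternating words of odd length.
\<close>

lemma reflection_count_alternating:
  assumes s: "s \<in> S" "r \<in> S"
  shows "t \<in> carrier G \<Longrightarrow> reflection_count (concat (replicate k [s, r])) t =
      (\<Sum>j<2 * k. of_bool (t = (s \<otimes> r) [^] j \<otimes> s))"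
proof (induction k arbitrary: t)
  case (Suc k)
  have conj: "a \<otimes> x \<otimes> a = y \<longleftrightarrow> x = a \<otimes> y \<otimes> a"
    if "a \<in> S" "x \<in> carrier G" "y \<in> carrier G" for a x y
    using that by (auto simp: m_assoc generators_involutive)
  have shift: "r \<otimes> (s \<otimes> t \<otimes> s) \<otimes> r = (s \<otimes> r) [^] j \<otimes> s \<longleftrightarrow> t = (s \<otimes> r) [^] (j + 2) \<otimes> s"
    for j :: nat
  proof -
    have "s \<otimes> (r \<otimes> ((s \<otimes> r) [^] j \<otimes> s) \<otimes> r) \<otimes> s = (s \<otimes> r) \<otimes> ((s \<otimes> r) [^] j \<otimes> (s \<otimes> r)) \<otimes> s"
      using s by (simp add: m_assoc)
    also have "\<dots> = (s \<otimes> r) [^] (j + 2) \<otimes> s"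
      using s by (metis add_2_eq_Suc' generator_closed m_closed nat_pow_Suc nat_pow_Suc2)
    finally show ?thesis using s Suc.prems by (simp add: conj)
  qed
  have "reflection_count (concat (replicate (Suc k) [s, r])) t =
      of_bool (t = s) + (of_bool (s \<otimes> t \<otimes> s = r) +
        reflection_count (concat (replicate k [s, r])) (r \<otimes> (s \<otimes> t \<otimes> s) \<otimes> r))"
    by simp
  also have "reflection_count (concat (replicate k [s, r])) (r \<otimes> (s \<otimes> t \<otimes> s) \<otimes> r) =
      (\<Sum>j<2 * k. of_bool (t = (s \<otimes> r) [^] (Suc (Suc j)) \<otimes> s))"
    using Suc.IH [of "r \<otimes> (s \<otimes> t \<otimes> s) \<otimes> r"] Suc.prems s shift by simp
  also have "s \<otimes> t \<otimes> s = r \<longleftrightarrow> t = (s \<otimes> r) [^] Suc 0 \<otimes> s"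
    using s Suc.prems by (simp add: conj)
  also have "t = s \<longleftrightarrow> t = (s \<otimes> r) [^] (0::nat) \<otimes> s"
    using s by simp
  finally show ?case
    by (simp only: mult_Suc_right add_2_eq_Suc sum.lessThan_Suc_shift o_def)
qed simp

text \<open>
  The sequence of reflections crossed by the relator \<open>(s r)\<^sup>m\<close> has length \<open>2 * m\<close> and period \<open>m\<close>, so
  every reflection is crossed an even number of times.
\<close>

lemma even_reflection_count_relator:
  assumes s: "s \<in> S" "r \<in> S" and m: "(s \<otimes> r) [^] m = \<one>" and t: "t \<in> carrier G"
  shows "even (reflection_count (concat (replicate m [s, r])) t)"
proof -
  let ?f = "\<lambda>j. of_bool (t = (s \<otimes> r) [^] j \<otimes> s) :: nat"
  have split: "(\<Sum>j<m + k. ?f j) = (\<Sum>j<m. ?f j) + (\<Sum>j<k. ?f j)" for k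
  proof (induction k)
    case (Suc k)
    have "(s \<otimes> r) [^] (m + k) = (s \<otimes> r) [^] k"
      using s m by (simp flip: nat_pow_mult)
    then show ?case using Suc by simp
  qed simp
  show ?thesis
    using split [of m] by (simp add: reflection_count_alternating s t mult_2)
qed

end

section \<open>The exchange condition and descents\<close>

unbundle fps_syntax

text \<open>
  The hypothesis of the exchange condition admits equal lengths.  Deletion would then shorten the
  element while its length stays the same, so left multiplication by a generator always changes
  the length.
\<close>

locale exchange_group = involution_generated_group +
  assumes exchange: "s \<in> S \<Longrightarrow> xs \<in> lists S \<Longrightarrow> len (s \<otimes> ev xs) \<le> len (ev xs) \<Longrightarrow>
      \<exists>ys r zs. xs = ys @ r # zs \<and> s \<otimes> ev xs = ev (ys @ zs)"
    and finite_generators: "finite S"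
begin

lemma len_generator_mult_neq:
  assumes "s \<in> S" "g \<in> carrier G"
  shows "len (s \<otimes> g) \<noteq> len g"
proof
  assume eq: "len (s \<otimes> g) = len g"
  obtain xs where xs: "xs \<in> lists S" "length xs = len g" "ev xs = g"
    using reduced_word assms(2) by blast
  obtain ys r zs where d: "xs = ys @ r # zs" "s \<otimes> g = ev (ys @ zs)"
    using exchange [OF assms(1) xs(1)] eq xs(3) by auto
  then show False
    using len_ev_le [of "ys @ zs"] xs eq by simp
qed

definition descents :: "'a \<Rightarrow> 'a set" where
  "descents g = {s \<in> S. len (s \<otimes> g) < len g}"

lemma len_descent: "s \<in> descents g \<Longrightarrow> g \<in> carrier G \<Longrightarrow> len g = Suc (len (s \<otimes> g))"
  using len_le_generator_mult [of s g] by (auto simp: descents_def)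

lemma descents_empty_iff:
  assumes "g \<in> carrier G"
  shows "descents g = {} \<longleftrightarrow> g = \<one>"
proof
  assume e: "descents g = {}"
  obtain xs where xs: "xs \<in> lists S" "length xs = len g" "ev xs = g"
    using reduced_word assms by blast
  show "g = \<one>"
  proof (cases xs)
    case (Cons s ys)
    then have "s \<otimes> ev (s # ys) = ev ys" using xs(1) by simp
    then have "s \<otimes> g = ev ys" using xs(3) Cons by simp
    then have "s \<in> descents g"
      using len_ev_le [of ys] xs Cons by (auto simp: descents_def)
    then show ?thesis using e by blast
  qed (use xs in simp)
qed (simp add: descents_def)

text \<open>
  The next two lemmas say that an element with two left descents \<open>x\<close> and \<open>y\<close> has reduced words
  starting with \<open>x y \<dots>\<close>, and with \<open>x y x \<dots>\<close> unless \<open>x\<close> and \<open>y\<close> commute.  In both, the exchange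
  condition is applied to a reduced word starting with \<open>y\<close>: deleting one of its first letters
  contradicts distinctness, reducedness or non-commutation, so a later letter is deleted.
\<close>

lemma descent_after_one_step:
  assumes g: "g \<in> carrier G" and "x \<in> descents g" "y \<in> descents g" "x \<noteq> y"
  shows "y \<in> descents (x \<otimes> g)"
proof -
  have S: "x \<in> S" "y \<in> S" using assms by (auto simp: descents_def)
  obtain ys where ys: "ys \<in> lists S" "length ys = len (y \<otimes> g)" "ev ys = y \<otimes> g"
    using reduced_word [of "y \<otimes> g"] S g by auto
  have ev: "ev (y # ys) = g" using S g by (simp add: ys(3))
  have "len (x \<otimes> ev (y # ys)) \<le> len (ev (y # ys))"
    using assms(2) ev by (simp add: descents_def)
  then obtain us r vs where d: "y # ys = us @ r # vs" "x \<otimes> g = ev (us @ vs)"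
    using exchange [of x "y # ys"] S ys(1) unfolding ev by (metis Cons_in_lists_iff)
  show ?thesis
  proof (cases us)
    case Nil
    then have "x \<otimes> g = y \<otimes> g" using d ys by simp
    then show ?thesis using S g assms(4) by simp
  next
    case (Cons u us')
    then have d': "ys = us' @ r # vs" "x \<otimes> g = y \<otimes> ev (us' @ vs)" using d by auto
    have l: "us' @ vs \<in> lists S" using ys(1) d'(1) by simp
    have "y \<otimes> (x \<otimes> g) = ev (us' @ vs)"
      using d'(2) S l by simp
    then have "Suc (len (y \<otimes> (x \<otimes> g))) \<le> length ys"
      using len_ev_le [OF l] d'(1) by simp
    then have "len (y \<otimes> (x \<otimes> g)) < len (x \<otimes> g)"
      using len_descent [OF assms(2) g] len_descent [OF assms(3) g] ys(2) by simp
    then show ?thesis using S by (simp add: descents_def)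
  qed
qed

lemma descent_after_two_steps:
  assumes g: "g \<in> carrier G" and "x \<in> descents g" "y \<in> descents g" "x \<otimes> y \<noteq> y \<otimes> x"
  shows "x \<in> descents (y \<otimes> (x \<otimes> g))"
proof -
  have S: "x \<in> S" "y \<in> S" using assms by (auto simp: descents_def)
  have yx: "y \<in> descents (x \<otimes> g)" and xy: "x \<in> descents (y \<otimes> g)"
    using descent_after_one_step [OF g assms(2,3)] descent_after_one_step [OF g assms(3,2)] assms(4)
    by auto
  have l: "len g = Suc (Suc (len (x \<otimes> (y \<otimes> g))))" "len g = Suc (Suc (len (y \<otimes> (x \<otimes> g))))"
    using len_descent [OF assms(3) g] len_descent [OF xy]
      len_descent [OF assms(2) g] len_descent [OF yx] S g by simp_all
  obtain zs where zs: "zs \<in> lists S" "length zs = len (x \<otimes> (y \<otimes> g))" "ev zs = x \<otimes> (y \<otimes> g)"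
    using reduced_word [of "x \<otimes> (y \<otimes> g)"] S g by auto
  have ev: "ev (y # x # zs) = g" using S g by (simp add: zs(3))
  have "len (x \<otimes> ev (y # x # zs)) \<le> len (ev (y # x # zs))"
    using assms(2) ev by (simp add: descents_def)
  then obtain us r vs where d: "y # x # zs = us @ r # vs" "x \<otimes> g = ev (us @ vs)"
    using exchange [of x "y # x # zs"] S zs(1) unfolding ev by (metis Cons_in_lists_iff)
  consider "us = []" | "us = [y]" | us' where "us = y # x # us'" "zs = us' @ r # vs"
    using d(1) by (auto simp: Cons_eq_append_conv)
  then show ?thesis
  proof cases
    case 1
    then have "us @ vs = x # zs" using d(1) by simp
    then have "x \<otimes> g = x \<otimes> ev zs" using d(2) by simp
    then have "g = ev zs" using S g zs(1) by simp
    then have "len g \<le> length zs" using len_ev_le [OF zs(1)] by simp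
    then show ?thesis using zs(2) l(1) by simp
  next
    \<comment> \<open>Deleting the \<open>x\<close> gives \<open>x y x = y\<close>.\<close>
    case 2
    then have "us @ vs = y # zs" using d(1) by simp
    then have "x \<otimes> g = y \<otimes> ev zs" using d(2) by simp
    moreover have "x \<otimes> g = (x \<otimes> (y \<otimes> x)) \<otimes> ev zs"
      using zs(1) S by (simp add: m_assoc ev [symmetric] del: cancel_generator)
    ultimately have "x \<otimes> (y \<otimes> x) = y"
      using S zs(1) right_cancel [of "ev zs" "x \<otimes> (y \<otimes> x)" y] by simp
    then have "y \<otimes> x = x \<otimes> y"
      using S cancel_generator [of x "y \<otimes> x"] by simp
    then show ?thesis using assms(4) by simp
  next
    case 3
    have l': "us' @ vs \<in> lists S" using zs(1) 3 by simp
    \<comment> \<open>The deleted letter lies in \<open>zs\<close>.\<close>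
    have "x \<otimes> g = y \<otimes> (x \<otimes> ev (us' @ vs))" using d(2) 3(1) by simp
    then have "x \<otimes> (y \<otimes> (x \<otimes> g)) = ev (us' @ vs)"
      using S l' by simp
    then have "len (x \<otimes> (y \<otimes> (x \<otimes> g))) < length zs"
      using len_ev_le [OF l'] 3(2) by simp
    then have "len (x \<otimes> (y \<otimes> (x \<otimes> g))) < len (y \<otimes> (x \<otimes> g))"
      using zs(2) l by simp
    then show ?thesis using S by (simp add: descents_def)
  qed
qed

text \<open>
  Infinite descent.  Stripping \<open>x\<close> from \<open>h\<close> rotates the hypotheses from \<open>(x, y, z)\<close> to
  \<open>(y, z, x)\<close>: the descent \<open>x\<close> comes back after \<open>x\<close> and \<open>y\<close> have been stripped because \<open>x\<close> and \<open>y\<close>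
  do not commute, and \<open>z\<close> survives the stripping of \<open>y\<close>.
\<close>

lemma no_rotating_descents:
  assumes "h \<in> carrier G" "x \<in> descents h" "y \<in> descents h"
    "y \<in> descents (x \<otimes> h)" "z \<in> descents (x \<otimes> h)"
    "x \<otimes> y \<noteq> y \<otimes> x" "y \<otimes> z \<noteq> z \<otimes> y" "z \<otimes> x \<noteq> x \<otimes> z"
  shows False
  using assms
proof (induction "len h" arbitrary: h x y z rule: less_induct)
  case less
  have S: "x \<in> S" "y \<in> S" using less.prems by (auto simp: descents_def)
  have "x \<in> descents (y \<otimes> (x \<otimes> h))"
    using descent_after_two_steps less.prems by blast
  moreover have "z \<in> descents (y \<otimes> (x \<otimes> h))"
    using descent_after_one_step [of "x \<otimes> h" y z] less.prems S by auto
  ultimately show False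
    using less.hyps [of "x \<otimes> h" y z x] less.prems S by (auto simp: descents_def)
qed

lemma card_descents_le_2:
  assumes noncomm: "\<And>x y. x \<in> S \<Longrightarrow> y \<in> S \<Longrightarrow> x \<noteq> y \<Longrightarrow> x \<otimes> y \<noteq> y \<otimes> x"
    and g: "g \<in> carrier G"
  shows "card (descents g) \<le> 2"
proof (rule ccontr)
  assume "\<not> ?thesis"
  then have "3 \<le> card (descents g)" by simp
  then obtain T where T: "T \<subseteq> descents g" "card T = 3"
    by (rule obtain_subset_with_card_n)
  then obtain x y z where xyz: "T = {x, y, z}" "x \<noteq> y" "y \<noteq> z" "x \<noteq> z"
    unfolding card_3_iff by blast
  then have d: "x \<in> descents g" "y \<in> descents g" "z \<in> descents g" using T(1) by blast+
  then have "x \<in> S" "y \<in> S" "z \<in> S" by (simp_all add: descents_def)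
  then show False
    using no_rotating_descents [OF g d(1,2) descent_after_one_step [OF g d(1,2)]
        descent_after_one_step [OF g d(1,3)]] xyz(2-4) noncomm
    by metis
qed

section \<open>Parabolic factorization\<close>

definition parabolic :: "'a set \<Rightarrow> 'a set" where
  "parabolic J = ev ` lists J"

text \<open>
  The representatives of minimal length of the right cosets of \<open>parabolic J\<close>, characterized
  by their descents.
\<close>

definition minimal :: "'a set \<Rightarrow> 'a set" where
  "minimal J = {g \<in> carrier G. J \<inter> descents g = {}}"

lemma lists_subset: "J \<subseteq> S \<Longrightarrow> xs \<in> lists J \<Longrightarrow> xs \<in> lists S"
  using lists_mono by blast

lemma parabolic_closed: "J \<subseteq> S \<Longrightarrow> v \<in> parabolic J \<Longrightarrow> v \<in> carrier G"
  by (metis ev_closed imageE lists_subset parabolic_def)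

lemma ev_parabolic: "xs \<in> lists J \<Longrightarrow> ev xs \<in> parabolic J"
  by (simp add: parabolic_def)

lemma parabolic_mult:
  assumes "J \<subseteq> S" "v \<in> parabolic J" "w \<in> parabolic J"
  shows "v \<otimes> w \<in> parabolic J"
proof -
  obtain xs ys where "xs \<in> lists J" "v = ev xs" "ys \<in> lists J" "w = ev ys"
    using assms(2,3) by (auto simp: parabolic_def)
  then have "v \<otimes> w = ev (xs @ ys)" "xs @ ys \<in> lists J"
    using lists_subset [OF assms(1)] by simp_all
  then show ?thesis by (simp add: ev_parabolic)
qed

lemma parabolic_inv:
  assumes "J \<subseteq> S" "v \<in> parabolic J"
  shows "inv v \<in> parabolic J"
proof -
  have "inv (ev xs) \<in> parabolic J" if "xs \<in> lists J" for xs
    using that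
  proof (induction xs rule: list.induct)
    case Nil
    then show ?case using ev_parabolic [of "[]" J] by simp
  next
    case (Cons s xs)
    then have s: "s \<in> J" "s \<in> S" "xs \<in> lists J" "xs \<in> lists S"
      using assms(1) lists_subset by auto
    then have "inv (ev (s # xs)) = inv (ev xs) \<otimes> ev [s]"
      by (simp add: inv_mult_group inv_generator)
    then show ?case
      using parabolic_mult [OF assms(1) Cons.IH ev_parabolic [of "[s]"]] s by simp
  qed
  then show ?thesis using assms(2) by (auto simp: parabolic_def)
qed

text \<open>
  Build up the parabolic factor letter by letter.  If a new letter \<open>s\<close> did not increase the length,
  the exchange condition would delete a letter, either of the parabolic word, which is reduced, or
  of \<open>u\<close>, which is shortest in its coset.  Taking \<open>u = \<one>\<close> shows that the length of a
  parabolic element is the same with respect to \<open>J\<close> and to \<open>S\<close>.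
\<close>

lemma len_mult_coset_minimum:
  assumes J: "J \<subseteq> S" and u: "u \<in> carrier G"
    and min: "\<And>v. v \<in> parabolic J \<Longrightarrow> len u \<le> len (v \<otimes> u)"
    and xs: "xs \<in> lists J" "length xs = word_length G J (ev xs)"
  shows "len (ev xs \<otimes> u) = length xs + len u"
  using xs
proof (induction xs rule: list.induct)
  case (Cons s xs)
  then have s: "s \<in> J" "s \<in> S" "xs \<in> lists J" "xs \<in> lists S"
    using J lists_subset by auto
  obtain ys where ys: "ys \<in> lists J" "length ys = word_length G J (ev xs)" "ev ys = ev xs"
    using word_length_witness [of "ev xs" G J] s(3) by auto
  have "word_length G J (ev (s # xs)) \<le> Suc (length ys)"
    using word_length_le [of "s # ys" J G] ys s by simp
  then have reduced: "length xs = word_length G J (ev xs)"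
    using Cons.prems(2) ys(2) word_length_le [OF s(3), of G] by simp
  then have IH: "len (ev xs \<otimes> u) = length xs + len u" using Cons.IH s(3) by simp
  obtain rs where rs: "rs \<in> lists S" "length rs = len u" "ev rs = u"
    using reduced_word u by blast
  have "\<not> len (s \<otimes> ev (xs @ rs)) \<le> len (ev (xs @ rs))"
  proof
    assume "len (s \<otimes> ev (xs @ rs)) \<le> len (ev (xs @ rs))"
    then obtain us r vs where d: "xs @ rs = us @ r # vs" "s \<otimes> ev (xs @ rs) = ev (us @ vs)"
      using exchange [of s "xs @ rs"] s rs(1) by (metis append_in_lists_conv)
    consider ws where "xs = us @ r # ws" "vs = ws @ rs"
      | ws where "us = xs @ ws" "rs = ws @ r # vs"
      using d(1) by (auto simp: append_eq_append_conv2 Cons_eq_append_conv append_eq_Cons_conv)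
    then show False
    proof cases
      \<comment> \<open>The deleted letter belongs to the parabolic word.\<close>
      case 1
      have w: "us @ ws \<in> lists J" "us @ ws \<in> lists S" using s(3,4) 1(1) by simp_all
      have "us @ vs = (us @ ws) @ rs" using 1(2) by simp
      then have "s \<otimes> ev xs \<otimes> u = ev (us @ ws) \<otimes> u"
        using d(2) ev_append [OF w(2) rs(1)] rs(1,3) s u by (simp add: m_assoc)
      then have "ev (s # xs) = ev (us @ ws)"
        using u s w(2) right_cancel [of u "s \<otimes> ev xs" "ev (us @ ws)"] by simp
      then have "word_length G J (ev (s # xs)) < length xs"
        using word_length_le [OF w(1), of G] 1(1) by simp
      then show False using Cons.prems(2) by simp
    next
      \<comment> \<open>The deleted letter belongs to the word of \<open>u\<close>.\<close>
      case 2
      have w: "ws @ vs \<in> lists S" using rs(1) 2(2) by simp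
      have "us @ vs = xs @ (ws @ vs)" using 2(1) by simp
      then have "s \<otimes> (ev xs \<otimes> u) = ev xs \<otimes> ev (ws @ vs)"
        using d(2) ev_append [OF s(4) w] ev_append [OF s(4) rs(1)] rs(3) by simp
      then have "inv (ev xs) \<otimes> (s \<otimes> (ev xs \<otimes> u)) = ev (ws @ vs)"
        using s w by (simp add: m_assoc [symmetric])
      then have "(inv (ev xs) \<otimes> (s \<otimes> ev xs)) \<otimes> u = ev (ws @ vs)"
        using s u by (simp add: m_assoc)
      moreover have "inv (ev xs) \<otimes> (s \<otimes> ev xs) \<in> parabolic J"
        using parabolic_mult [OF J parabolic_inv [OF J ev_parabolic [OF s(3)]]
            ev_parabolic [of "s # xs" J]] s by simp
      ultimately have "len u \<le> length (ws @ vs)"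
        using min len_ev_le [OF w] by fastforce
      then show False using rs(2) 2(2) by simp
    qed
  qed
  then have "len (s \<otimes> (ev xs \<otimes> u)) > len (ev xs \<otimes> u)"
    using rs s by simp
  then have "len (s \<otimes> (ev xs \<otimes> u)) = Suc (len (ev xs \<otimes> u))"
    using len_generator_mult_le [of s "ev xs \<otimes> u"] s u by simp
  then show ?case using IH s u by (simp add: m_assoc)
qed (use u in simp)

lemma len_eq_parabolic_len:
  assumes "J \<subseteq> S" "v \<in> parabolic J"
  shows "len v = word_length G J v"
proof -
  obtain xs where xs: "xs \<in> lists J" "length xs = word_length G J v" "ev xs = v"
    using word_length_witness [of v G J] assms(2) by (auto simp: parabolic_def)
  then show ?thesis
    using len_mult_coset_minimum [OF assms(1) one_closed _ xs(1)] parabolic_closed [OF assms]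
    by simp
qed

lemma len_parabolic_mult_coset_minimum:
  assumes J: "J \<subseteq> S" and u: "u \<in> carrier G"
    and min: "\<And>v. v \<in> parabolic J \<Longrightarrow> len u \<le> len (v \<otimes> u)"
    and v: "v \<in> parabolic J"
  shows "len (v \<otimes> u) = len v + len u"
proof -
  obtain xs where xs: "xs \<in> lists J" "length xs = word_length G J v" "ev xs = v"
    using word_length_witness [of v G J] v by (auto simp: parabolic_def)
  then show ?thesis
    using len_mult_coset_minimum [OF J u min xs(1)] len_eq_parabolic_len [OF J v] by simp
qed

lemma coset_minimum_exists:
  assumes J: "J \<subseteq> S" and g: "g \<in> carrier G"
  obtains v u where "v \<in> parabolic J" "u \<in> carrier G" "g = v \<otimes> u"
    "\<And>w. w \<in> parabolic J \<Longrightarrow> len (w \<otimes> u) = len w + len u"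
proof -
  have "\<exists>v. v \<in> parabolic J" using ev_parabolic [of "[]" J] by auto
  then obtain v where v: "v \<in> parabolic J"
    and min: "\<And>w. w \<in> parabolic J \<Longrightarrow> len (v \<otimes> g) \<le> len (w \<otimes> g)"
    using ex_has_least_nat [of "\<lambda>v. v \<in> parabolic J" _ "\<lambda>v. len (v \<otimes> g)"] by blast
  note closed = parabolic_closed [OF J]
  have u: "v \<otimes> g \<in> carrier G" using closed v g by simp
  have "len (v \<otimes> g) \<le> len (w \<otimes> (v \<otimes> g))" if "w \<in> parabolic J" for w
    using min [OF parabolic_mult [OF J that v]] closed that v g by (simp add: m_assoc)
  then have "len (w \<otimes> (v \<otimes> g)) = len w + len (v \<otimes> g)" if "w \<in> parabolic J" for w
    using len_parabolic_mult_coset_minimum [OF J u] that by blast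
  moreover have "g = inv v \<otimes> (v \<otimes> g)" using closed [OF v] g by (simp add: m_assoc [symmetric])
  ultimately show ?thesis using that [OF parabolic_inv [OF J v] u] by blast
qed

text \<open>
  An element without descents in \<open>J\<close> is the shortest in its coset: otherwise it is \<open>w \<otimes> u\<close> with \<open>u\<close>
  shortest and \<open>w\<close> nontrivial, and the first letter of \<open>w\<close> is a descent.
\<close>

lemma len_parabolic_mult_minimal:
  assumes J: "J \<subseteq> S" and m: "m \<in> minimal J" and v: "v \<in> parabolic J"
  shows "len (v \<otimes> m) = len v + len m"
proof -
  have mG: "m \<in> carrier G" using m by (simp add: minimal_def)
  obtain w u where w: "w \<in> parabolic J" and u: "u \<in> carrier G" and mwu: "m = w \<otimes> u"
    and add: "\<And>v. v \<in> parabolic J \<Longrightarrow> len (v \<otimes> u) = len v + len u"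
    using coset_minimum_exists [OF J mG] by blast
  obtain xs where xs: "xs \<in> lists J" "length xs = len w" "ev xs = w"
    using word_length_witness [of w G J] w len_eq_parabolic_len [OF J w]
    by (auto simp: parabolic_def)
  show ?thesis
  proof (cases xs)
    case Nil
    then have "w = \<one>" using xs(3) by simp
    then have "m = u" using mwu u by simp
    then show ?thesis using add v by simp
  next
    case (Cons s ys)
    then have s: "s \<in> J" "s \<in> S" "ys \<in> lists J" "ys \<in> lists S"
      using xs(1) J lists_subset by auto
    have w': "w = s \<otimes> ev ys" using xs(3) Cons by simp
    have "s \<otimes> m = ev ys \<otimes> u" using s u by (simp add: mwu w' m_assoc)
    then have "len (s \<otimes> m) = len (ev ys) + len u"
      using add [OF ev_parabolic [OF s(3)]] by simp
    moreover have "len m = len w + len u" using add [OF w] mwu by simp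
    moreover have "len (ev ys) < len w" using len_ev_le [OF s(4)] xs(2) Cons by simp
    ultimately have "s \<in> descents m" using s(2) by (simp add: descents_def)
    then show ?thesis using m s(1) by (auto simp: minimal_def)
  qed
qed

lemma parabolic_factorization:
  assumes J: "J \<subseteq> S"
  shows "bij_betw (\<lambda>(v, m). v \<otimes> m) (parabolic J \<times> minimal J) (carrier G)"
proof -
  note closed = parabolic_closed [OF J]
  have inj: "v = v' \<and> m = m'"
    if *: "v \<in> parabolic J" "v' \<in> parabolic J" "m \<in> minimal J" "m' \<in> minimal J"
      and eq: "v \<otimes> m = v' \<otimes> m'" for v v' m m'
  proof -
    have G: "v \<in> carrier G" "v' \<in> carrier G" "m \<in> carrier G" "m' \<in> carrier G"
      using * closed by (auto simp: minimal_def)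
    let ?a = "inv v' \<otimes> v"
    have a: "?a \<in> parabolic J" using * by (intro parabolic_mult parabolic_inv J)
    have m': "m' = ?a \<otimes> m"
      using G eq by (simp add: m_assoc inv_solve_left)
    have m: "m = inv ?a \<otimes> m'"
      using inv_solve_left [of m ?a m'] m' G by simp
    have "len m' = len ?a + len m"
      using len_parabolic_mult_minimal [OF J *(3) a] m' by simp
    moreover have "len m = len (inv ?a) + len m'"
      using len_parabolic_mult_minimal [OF J *(4) parabolic_inv [OF J a]] m by simp
    ultimately have "len ?a = 0" by simp
    then have "?a = \<one>" using len_eq_0_iff G by simp
    then have "v = v'" using inv_solve_left [of \<one> v' v] G by simp
    moreover have "m = m'" using m' \<open>?a = \<one>\<close> G by simp
    ultimately show ?thesis by blast
  qed
  have surj: "\<exists>v m. v \<in> parabolic J \<and> m \<in> minimal J \<and> g = v \<otimes> m" if g: "g \<in> carrier G" for g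
  proof -
    obtain v u where vu: "v \<in> parabolic J" "u \<in> carrier G" "g = v \<otimes> u"
      and add: "\<And>v. v \<in> parabolic J \<Longrightarrow> len (v \<otimes> u) = len v + len u"
      using coset_minimum_exists [OF J g] by blast
    have "s \<notin> descents u" if "s \<in> J" for s
      using add [OF ev_parabolic [of "[s]" J]] that J by (auto simp: descents_def)
    then have "u \<in> minimal J" using vu(2) by (auto simp: minimal_def)
    then show ?thesis using vu by blast
  qed
  show ?thesis
    unfolding bij_betw_def
  proof
    show "inj_on (\<lambda>(v, m). v \<otimes> m) (parabolic J \<times> minimal J)"
      using inj by (auto simp: inj_on_def)
    show "(\<lambda>(v, m). v \<otimes> m) ` (parabolic J \<times> minimal J) = carrier G"
      using surj closed by (force simp: minimal_def)
  qed
qed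

section \<open>Length series\<close>

lemma finite_sphere: "finite {g \<in> carrier G. len g = k}"
proof (rule finite_subset)
  show "{g \<in> carrier G. len g = k} \<subseteq> ev ` {xs. set xs \<subseteq> S \<and> length xs = k}"
  proof
    fix g assume "g \<in> {g \<in> carrier G. len g = k}"
    then obtain xs where "xs \<in> lists S" "length xs = k" "ev xs = g"
      using reduced_word [of g] by auto
    then show "g \<in> ev ` {xs. set xs \<subseteq> S \<and> length xs = k}" by auto
  qed
  show "finite (ev ` {xs. set xs \<subseteq> S \<and> length xs = k})"
    using finite_generators by (simp add: finite_lists_length_eq)
qed

definition length_series :: "'a set \<Rightarrow> rat fps" where
  "length_series X = Abs_fps (\<lambda>k. of_nat (card {g \<in> X. len g = k}))"

lemma growth_series_eq_length_series: "growth_series G S = length_series (carrier G)"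
  by (simp add: growth_series_def length_series_def)

lemma length_series_one: "length_series {\<one>} = 1"
proof (rule fps_ext)
  fix k
  have "{g. g = \<one> \<and> len g = k} = (if k = 0 then {\<one>} else {})" by auto
  then show "length_series {\<one>} $ k = 1 $ k"
    by (simp add: length_series_def)
qed

text \<open>
  The factorization adds lengths, so it multiplies series.
\<close>

lemma length_series_parabolic_mult_minimal:
  assumes J: "J \<subseteq> S"
  shows "length_series (parabolic J) * length_series (minimal J) = length_series (carrier G)"
proof (rule fps_ext)
  fix k
  let ?V = "\<lambda>i. {v \<in> parabolic J. len v = i}" and ?M = "\<lambda>i. {m \<in> minimal J. len m = i}"
  have fin: "finite (?V i)" "finite (?M i)" for i
    by (rule finite_subset [OF _ finite_sphere [of i]], use parabolic_closed [OF J] minimal_def in auto)+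
  have "bij_betw (\<lambda>(v, m). v \<otimes> m) (\<Union>i\<in>{0..k}. ?V i \<times> ?M (k - i)) {g \<in> carrier G. len g = k}"
  proof (rule bij_betw_subset [OF parabolic_factorization [OF J]])
    show "(\<Union>i\<in>{0..k}. ?V i \<times> ?M (k - i)) \<subseteq> parabolic J \<times> minimal J" by blast
    show "(\<lambda>(v, m). v \<otimes> m) ` (\<Union>i\<in>{0..k}. ?V i \<times> ?M (k - i)) = {g \<in> carrier G. len g = k}"
    proof (intro equalityI subsetI)
      fix g assume g: "g \<in> {g \<in> carrier G. len g = k}"
      then have "g \<in> (\<lambda>(v, m). v \<otimes> m) ` (parabolic J \<times> minimal J)"
        using bij_betw_imp_surj_on [OF parabolic_factorization [OF J]] by simp
      then obtain v m where "v \<in> parabolic J" "m \<in> minimal J" "g = v \<otimes> m"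
        by auto
      with g show "g \<in> (\<lambda>(v, m). v \<otimes> m) ` (\<Union>i\<in>{0..k}. ?V i \<times> ?M (k - i))"
        using len_parabolic_mult_minimal [OF J, of m v] by force
    qed (use parabolic_closed [OF J] len_parabolic_mult_minimal [OF J] minimal_def in auto)
  qed
  then have "card {g \<in> carrier G. len g = k} = card (\<Union>i\<in>{0..k}. ?V i \<times> ?M (k - i))"
    by (rule bij_betw_same_card [symmetric])
  also have "\<dots> = (\<Sum>i=0..k. card (?V i \<times> ?M (k - i)))"
    by (rule card_UN_disjoint) (use fin in auto)
  finally show "(length_series (parabolic J) * length_series (minimal J)) $ k =
      length_series (carrier G) $ k"
    by (simp add: length_series_def fps_mult_nth card_cartesian_product)
qed

lemma length_series_parabolic_singleton:
  assumes s: "s \<in> S"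
  shows "length_series (parabolic {s}) = 1 + fps_X"
proof -
  have ev: "ev xs = \<one> \<or> ev xs = s" if "xs \<in> lists {s}" for xs
    using that
  proof (induction xs rule: list.induct)
    case (Cons x xs)
    then have "x = s" "ev xs = \<one> \<or> ev xs = s" by auto
    then show ?case using s generators_involutive by auto
  qed simp
  have "parabolic {s} = {\<one>, s}"
    using ev ev_parabolic [of "[]" "{s}"] ev_parabolic [of "[s]" "{s}"] s
    by (auto simp: parabolic_def)
  moreover have "len s = 1"
    using len_generator_mult_neq [OF s one_closed] len_generator_mult_le [OF s one_closed] s
    by simp
  moreover have "s \<noteq> \<one>" using calculation(2) by auto
  ultimately have "{g \<in> parabolic {s}. len g = k} =
      (if k = 0 then {\<one>} else if k = 1 then {s} else {})" for k
    by auto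
  then show ?thesis
    by (intro fps_ext) (simp add: length_series_def fps_X_def)
qed

lemma finite_descents: "finite (descents g)"
  using finite_generators by (simp add: descents_def)

lemma length_series_nth_sum:
  assumes "X \<subseteq> carrier G"
  shows "length_series X $ k = (\<Sum>g | g \<in> carrier G \<and> len g = k. of_bool (g \<in> X))"
proof -
  have "{g \<in> X. len g = k} = {g \<in> carrier G. len g = k} \<inter> {g. g \<in> X}" using assms by auto
  then show ?thesis
    using finite_sphere by (simp add: length_series_def sum_of_bool_eq)
qed

lemma card_pairs_disjoint_from:
  assumes "finite X"
  shows "card {J. J \<subseteq> X \<and> card J = 2 \<and> J \<inter> D = {}} = card (X - D) choose 2"
proof -
  have "{J. J \<subseteq> X \<and> card J = 2 \<and> J \<inter> D = {}} = {J. J \<subseteq> X - D \<and> card J = 2}" by blast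
  then show ?thesis using n_subsets [of "X - D" 2] assms by simp
qed

lemma of_nat_choose_two: "(of_nat (n choose 2) :: rat) = of_nat n * (of_nat n - 1) / 2"
proof (induction n)
  case (Suc n)
  have "Suc n choose 2 = n + (n choose 2)" by (simp add: numeral_2_eq_2)
  then show ?case using Suc by (simp add: field_simps)
qed simp

text \<open>
  For fixed \<open>n\<close>, this is the quadratic polynomial in \<open>n - d\<close> that is \<open>1\<close> at \<open>d = 0\<close> and vanishes at
  \<open>d = 1\<close> and \<open>d = 2\<close>.  It is written in the basis \<open>1\<close>, \<open>n - d\<close>, \<open>(n - d) choose 2\<close>, since these count the sets of at most
  two generators that contain none of \<open>d\<close> given ones.
\<close>

lemma descent_count_identity:
  fixes d n :: nat
  assumes "d \<le> 2" "d \<le> n"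
  shows "(of_bool (d = 0) :: rat) =
    (of_nat n - 1) * (of_nat n - 2) / 2 - (of_nat n - 2) * of_nat (n - d) + of_nat ((n - d) choose 2)"
proof -
  consider "d = 0" | "d = 1" | "d = 2" using assms(1) by linarith
  then show ?thesis
    using assms(2)
    by cases (auto simp: of_nat_choose_two of_nat_diff field_simps)
qed

text \<open>
  Only the neutral element has no descent.  Apply \<open>descent_count_identity\<close> to each element, with \<open>d\<close> the
  number of its descents, and sum over all elements with weight \<open>t\<close> to the length.
\<close>

lemma length_series_inclusion_exclusion:
  assumes descents: "\<And>g. g \<in> carrier G \<Longrightarrow> card (descents g) \<le> 2"
  defines "c \<equiv> (of_nat (card S) :: rat)"
  shows "1 = fps_const ((c - 1) * (c - 2) / 2) * length_series (carrier G)
    - fps_const (c - 2) * (\<Sum>s\<in>S. length_series (minimal {s}))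
    + (\<Sum>J | J \<subseteq> S \<and> card J = 2. length_series (minimal J))"
proof (rule fps_ext)
  fix k
  let ?X = "{g \<in> carrier G. len g = k}"
  have min: "minimal J \<subseteq> carrier G" for J by (auto simp: minimal_def)
  have pointwise: "(of_bool (g = \<one>) :: rat) = (c - 1) * (c - 2) / 2
      - (c - 2) * (\<Sum>s\<in>S. of_bool (g \<in> minimal {s}))
      + (\<Sum>J | J \<subseteq> S \<and> card J = 2. of_bool (g \<in> minimal J))" if g: "g \<in> carrier G" for g
  proof -
    let ?D = "descents g"
    have D: "?D \<subseteq> S" by (auto simp: descents_def)
    have card_diff: "card (S - ?D) = card S - card ?D"
      using D finite_descents by (simp add: card_Diff_subset)
    have "(\<Sum>s\<in>S. of_bool (g \<in> minimal {s})) = (of_nat (card (S - ?D)) :: rat)"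
      using finite_generators g by (simp add: minimal_def sum_of_bool_eq Diff_eq Compl_eq)
    moreover have "(\<Sum>J | J \<subseteq> S \<and> card J = 2. of_bool (g \<in> minimal J)) =
        (of_nat (card (S - ?D) choose 2) :: rat)"
    proof -
      have "{J. J \<subseteq> S \<and> card J = 2} \<inter> {J. J \<inter> ?D = {}} =
          {J. J \<subseteq> S \<and> card J = 2 \<and> J \<inter> ?D = {}}" by blast
      then show ?thesis
        using finite_generators g card_pairs_disjoint_from [of S ?D]
        by (simp add: minimal_def sum_of_bool_eq)
    qed
    moreover have "g = \<one> \<longleftrightarrow> card ?D = 0"
      using descents_empty_iff [OF g] finite_descents by simp
    ultimately show ?thesis
      using descent_count_identity [of "card ?D" "card S"] descents [OF g]
        card_mono [OF finite_generators D] card_diff by (simp add: c_def)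
  qed
  have "(1 :: rat fps) $ k = length_series {\<one>} $ k" by (simp add: length_series_one)
  also have "\<dots> = (\<Sum>g\<in>?X. of_bool (g = \<one>))"
    using length_series_nth_sum [of "{\<one>}" k] by simp
  also have "\<dots> = (\<Sum>g\<in>?X. (c - 1) * (c - 2) / 2
      - (c - 2) * (\<Sum>s\<in>S. of_bool (g \<in> minimal {s}))
      + (\<Sum>J | J \<subseteq> S \<and> card J = 2. of_bool (g \<in> minimal J)))"
    by (rule sum.cong) (use pointwise in auto)
  also have "\<dots> = (c - 1) * (c - 2) / 2 * length_series (carrier G) $ k
      - (c - 2) * (\<Sum>s\<in>S. length_series (minimal {s}) $ k)
      + (\<Sum>J | J \<subseteq> S \<and> card J = 2. length_series (minimal J) $ k)"
    unfolding length_series_nth_sum [OF min]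
    by (simp add: sum.distrib sum_subtractf sum_distrib_left length_series_def
        sum.swap [of _ S] sum.swap [of _ "{J. J \<subseteq> S \<and> card J = 2}"])
  finally show "(1 :: rat fps) $ k = (fps_const ((c - 1) * (c - 2) / 2) * length_series (carrier G)
    - fps_const (c - 2) * (\<Sum>s\<in>S. length_series (minimal {s}))
    + (\<Sum>J | J \<subseteq> S \<and> card J = 2. length_series (minimal J))) $ k"
    by (simp add: fps_sum_nth)
qed

text \<open>
  Replace the series of the minimal elements in the previous identity by quotients: for one
  generator it is \<open>P / (1 + t)\<close>, for two it is \<open>P / P2\<close>.  Clearing denominators gives the claim.
\<close>

lemma growth_series_formula:
  fixes P2 :: "rat fps"
  assumes noncomm: "\<And>x y. x \<in> S \<Longrightarrow> y \<in> S \<Longrightarrow> x \<noteq> y \<Longrightarrow> x \<otimes> y \<noteq> y \<otimes> x"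
    and P2: "\<And>J. J \<subseteq> S \<Longrightarrow> card J = 2 \<Longrightarrow> length_series (parabolic J) = P2"
  defines "c \<equiv> (of_nat (card S) :: rat)"
  shows "growth_series G S *
    (fps_const ((c - 1) * (c - 2) / 2) * fps_X * P2 - fps_const ((c + 1) * (c - 2) / 2) * P2
      + fps_const (c * (c - 1) / 2) * (1 + fps_X)) = (1 + fps_X) * P2"
proof -
  let ?P = "growth_series G S" and ?Q = "1 + fps_X :: rat fps"
  let ?M1 = "\<Sum>s\<in>S. length_series (minimal {s})"
    and ?M2 = "\<Sum>J | J \<subseteq> S \<and> card J = 2. length_series (minimal J)"
  have 1: "?Q * ?M1 = fps_const c * ?P"
  proof -
    have "?Q * ?M1 = (\<Sum>s\<in>S. ?P)"
      unfolding sum_distrib_left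
      by (rule sum.cong) (use length_series_parabolic_singleton
          length_series_parabolic_mult_minimal [of "{_}"] in
          \<open>simp_all add: growth_series_eq_length_series\<close>)
    then show ?thesis by (simp add: c_def fps_of_nat)
  qed
  have 2: "P2 * ?M2 = fps_const (c * (c - 1) / 2) * ?P"
  proof -
    have "P2 * ?M2 = (\<Sum>J | J \<subseteq> S \<and> card J = 2. ?P)"
      unfolding sum_distrib_left
      by (rule sum.cong) (use P2 length_series_parabolic_mult_minimal in
          \<open>auto simp: growth_series_eq_length_series\<close>)
    also have "\<dots> = fps_const (of_nat (card S choose 2)) * ?P"
      using n_subsets [OF finite_generators, of 2] by (simp add: fps_of_nat)
    also have "(of_nat (card S choose 2) :: rat) = c * (c - 1) / 2"
      by (simp add: of_nat_choose_two c_def)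
    finally show ?thesis by simp
  qed
  \<comment> \<open>Here non-commutation enters, through the bound on the number of descents.\<close>
  have id: "1 = fps_const ((c - 1) * (c - 2) / 2) * ?P - fps_const (c - 2) * ?M1 + ?M2"
    using length_series_inclusion_exclusion card_descents_le_2 [OF noncomm]
    by (simp add: growth_series_eq_length_series c_def)
  have "?Q * P2 = ?Q * P2 * (fps_const ((c - 1) * (c - 2) / 2) * ?P - fps_const (c - 2) * ?M1 + ?M2)"
    using id by simp
  also have "\<dots> = fps_const ((c - 1) * (c - 2) / 2) * ?Q * P2 * ?P
      - fps_const (c - 2) * P2 * (?Q * ?M1) + ?Q * (P2 * ?M2)"
    by (simp only: algebra_simps)
  also have "\<dots> = ?P * (fps_const ((c - 1) * (c - 2) / 2) * fps_X * P2
      + (fps_const ((c - 1) * (c - 2) / 2) - fps_const (c - 2) * fps_const c) * P2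
      + fps_const (c * (c - 1) / 2) * ?Q)"
    unfolding 1 2 by (simp only: algebra_simps mult_1_left mult_1_right)
  also have "fps_const ((c - 1) * (c - 2) / 2) - fps_const (c - 2) * fps_const c =
      - fps_const ((c + 1) * (c - 2) / 2)"
  proof -
    have "(c - 1) * (c - 2) / 2 - (c - 2) * c = - ((c + 1) * (c - 2) / 2)"
      by (simp add: add_divide_distrib diff_divide_distrib algebra_simps)
    then show ?thesis by (simp only: fps_const_mult fps_const_sub fps_const_neg)
  qed
  finally show ?thesis
    by (simp only: mult_minus_left add_uminus_conv_diff)
qed

end

section \<open>The Weyl group satisfies the exchange condition\<close>

text \<open>
  The parity of reflection counts only has to be checked on the defining relations: inserting a
  word of value \<open>\<one>\<close> with even counts does not affect the conjugations made by the letters after it.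
\<close>

lemma (in involution_generated_group) pres_eq_reflection_parity:
  assumes gen: "\<sigma> ` I \<subseteq> S"
    and relators: "\<And>r. r \<in> R \<Longrightarrow> r \<in> signed_words I \<Longrightarrow> ev (map (\<sigma> \<circ> fst) r) = \<one>"
      "\<And>r t. r \<in> R \<Longrightarrow> r \<in> signed_words I \<Longrightarrow> t \<in> carrier G \<Longrightarrow>
        even (reflection_count (map (\<sigma> \<circ> fst) r) t)"
    and eq: "pres_eq I R u v"
  shows "ev (map (\<sigma> \<circ> fst) u) = ev (map (\<sigma> \<circ> fst) v) \<and>
    (\<forall>t\<in>carrier G. even (reflection_count (map (\<sigma> \<circ> fst) u) t) \<longleftrightarrow>
      even (reflection_count (map (\<sigma> \<circ> fst) v) t))"
proof -
  have word: "map (\<sigma> \<circ> fst) u \<in> lists S" if "u \<in> signed_words I" for u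
    using that gen by (fastforce simp: signed_words_def)
  have insert: "ev (map (\<sigma> \<circ> fst) (u @ r @ v)) = ev (map (\<sigma> \<circ> fst) (u @ v)) \<and>
    (\<forall>t\<in>carrier G. even (reflection_count (map (\<sigma> \<circ> fst) (u @ r @ v)) t) \<longleftrightarrow>
      even (reflection_count (map (\<sigma> \<circ> fst) (u @ v)) t))"
    if "u \<in> signed_words I" "v \<in> signed_words I" "r \<in> signed_words I"
      and r: "ev (map (\<sigma> \<circ> fst) r) = \<one>"
        "\<And>t. t \<in> carrier G \<Longrightarrow> even (reflection_count (map (\<sigma> \<circ> fst) r) t)" for u v r
  proof -
    note w = that(1-3) [THEN word]
    have "ev (map (\<sigma> \<circ> fst) u) \<in> carrier G" using w(1) by (rule ev_closed)
    then show ?thesis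
      using w r by (simp add: reflection_count_append del: map_map in_lists_conv_set)
  qed
  show ?thesis
    using eq
  proof (induction rule: pres_eq.induct)
    case (cancel u v s b)
    have s: "\<sigma> s \<in> S" using cancel gen by blast
    have r: "map (\<sigma> \<circ> fst) [(s, b), (s, \<not> b)] = concat (replicate 1 [\<sigma> s, \<sigma> s])" by simp
    show ?case
    proof (rule insert)
      show "even (reflection_count (map (\<sigma> \<circ> fst) [(s, b), (s, \<not> b)]) t)"
        if "t \<in> carrier G" for t
        unfolding r using s that by (intro even_reflection_count_relator)
          (simp_all add: generators_involutive)
      show "ev (map (\<sigma> \<circ> fst) [(s, b), (s, \<not> b)]) = \<one>"
        using s by (simp add: generators_involutive)
    qed (use cancel in \<open>simp_all add: signed_words_def\<close>)
  next
    case (relator u v r)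
    then show ?case using insert relators by blast
  qed auto
qed

text \<open>
  Since the generators are involutions, words without formal inverses represent all elements.
\<close>

definition pos_word :: "'i list \<Rightarrow> 'i signed_word" where
  "pos_word = map (\<lambda>i. (i, True))"

lemma pos_word_simps [simp]:
  "pos_word [] = []" "pos_word (i # ks) = (i, True) # pos_word ks"
  "pos_word (ks @ js) = pos_word ks @ pos_word js"
  "length (pos_word ks) = length ks" "map (\<sigma> \<circ> fst) (pos_word ks) = map \<sigma> ks"
  by (simp_all add: pos_word_def)

lemma pos_word_signed_words [simp]: "pos_word ks \<in> signed_words I \<longleftrightarrow> ks \<in> lists I"
  by (induction ks) (auto simp: signed_words_def)

lemma signed_words_Nil [simp]: "[] \<in> signed_words I"
  and signed_words_Cons [simp]: "p # u \<in> signed_words I \<longleftrightarrow> fst p \<in> I \<and> u \<in> signed_words I"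
  and signed_words_append [simp]: "u @ v \<in> signed_words I \<longleftrightarrow> u \<in> signed_words I \<and> v \<in> signed_words I"
  by (cases p; auto simp: signed_words_def)+

lemma map_fst_signed_words: "u \<in> signed_words I \<Longrightarrow> map fst u \<in> lists I"
  by (induction u) simp_all

abbreviation weyl_eq :: "'i set \<Rightarrow> ('i \<Rightarrow> 'i \<Rightarrow> int) \<Rightarrow> 'i signed_word \<Rightarrow> 'i signed_word \<Rightarrow> bool" where
  "weyl_eq I A \<equiv> pres_eq I (coxeter_relators I A)"

abbreviation weyl_class :: "'i set \<Rightarrow> ('i \<Rightarrow> 'i \<Rightarrow> int) \<Rightarrow> 'i signed_word \<Rightarrow> 'i signed_word set" where
  "weyl_class I A \<equiv> pres_class I (coxeter_relators I A)"

abbreviation weyl_gen :: "'i set \<Rightarrow> ('i \<Rightarrow> 'i \<Rightarrow> int) \<Rightarrow> 'i \<Rightarrow> 'i signed_word set" where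
  "weyl_gen I A i \<equiv> weyl_class I A [(i, True)]"

lemma weyl_eq_square: "i \<in> I \<Longrightarrow> weyl_eq I A [(i, True), (i, True)] []"
  using pres_eq.relator [of "[]" I "[]" "[(i, True), (i, True)]" "coxeter_relators I A"]
  by (auto simp: coxeter_relators_def)

lemma weyl_eq_letter: "i \<in> I \<Longrightarrow> weyl_eq I A [(i, b)] [(i, True)]"
proof (cases b)
  case False
  assume i: "i \<in> I"
  have "weyl_eq I A ([(i, False)] @ [(i, True), (i, True)]) ([(i, False)] @ [])"
    by (rule pres_eq_append_left [OF weyl_eq_square [OF i]]) (simp add: i)
  moreover have "weyl_eq I A ([] @ [(i, False), (i, \<not> False)] @ [(i, True)]) ([] @ [(i, True)])"
    by (rule pres_eq.cancel) (simp_all add: i)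
  ultimately show ?thesis
    using False by (auto intro: pres_eq.trans pres_eq.sym)
qed (simp add: pres_eq.refl)

lemma weyl_eq_pos_word:
  "u \<in> signed_words I \<Longrightarrow> weyl_eq I A u (pos_word (map fst u))"
proof (induction u)
  case (Cons p u)
  then have "weyl_eq I A [p] [(fst p, True)]"
    using weyl_eq_letter [of "fst p" I A "snd p"] by simp
  then show ?case
    using Cons pres_eq_append [of I "coxeter_relators I A" "[p]" _ u] by fastforce
qed (simp add: pres_eq.refl)

lemma weyl_class_eq_iff:
  "u \<in> signed_words I \<Longrightarrow> weyl_class I A u = weyl_class I A v \<longleftrightarrow> weyl_eq I A u v"
  by (rule pres_class_eq_iff)

lemma weyl_one: "\<one>\<^bsub>weyl_group I A\<^esub> = weyl_class I A []"
  by (simp add: weyl_group_def presented_group_def)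

lemma weyl_mult:
  "u \<in> signed_words I \<Longrightarrow> v \<in> signed_words I \<Longrightarrow>
    weyl_class I A u \<otimes>\<^bsub>weyl_group I A\<^esub> weyl_class I A v = weyl_class I A (u @ v)"
  by (simp add: weyl_group_def presented_group_mult)

lemma carrier_weyl_group: "carrier (weyl_group I A) = weyl_class I A ` signed_words I"
  by (simp add: weyl_group_def presented_group_def)

lemma word_value_weyl_gen:
  "ks \<in> lists I \<Longrightarrow>
    word_value (weyl_group I A) (map (weyl_gen I A) ks) = weyl_class I A (pos_word ks)"
  by (induction ks rule: list.induct) (auto simp: weyl_one weyl_mult)

lemma involution_generated_weyl_group:
  "involution_generated_group (weyl_group I A) (weyl_generators I A)"
proof -
  interpret group "weyl_group I A"
    unfolding weyl_group_def by (rule group_presented_group)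
  show ?thesis
  proof
    show "weyl_generators I A \<subseteq> carrier (weyl_group I A)"
      by (auto simp: weyl_generators_def carrier_weyl_group)
    show "s \<otimes>\<^bsub>weyl_group I A\<^esub> s = \<one>\<^bsub>weyl_group I A\<^esub>" if "s \<in> weyl_generators I A" for s
    proof -
      obtain i where "i \<in> I" "s = weyl_gen I A i"
        using \<open>s \<in> weyl_generators I A\<close> by (auto simp: weyl_generators_def)
      then show ?thesis
        using weyl_eq_square [of i I A] by (simp add: weyl_mult weyl_one weyl_class_eq_iff)
    qed
    show "carrier (weyl_group I A) \<subseteq> word_value (weyl_group I A) ` lists (weyl_generators I A)"
    proof
      fix g assume "g \<in> carrier (weyl_group I A)"
      then obtain u where u: "u \<in> signed_words I" "g = weyl_class I A u"
        by (auto simp: carrier_weyl_group)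
      have w: "map fst u \<in> lists I" using u(1) by (rule map_fst_signed_words)
      have "g = word_value (weyl_group I A) (map (weyl_gen I A) (map fst u))"
        using u weyl_eq_pos_word [OF u(1)] word_value_weyl_gen [OF w]
        by (simp add: weyl_class_eq_iff)
      moreover have "map (weyl_gen I A) (map fst u) \<in> lists (weyl_generators I A)"
        unfolding weyl_generators_def lists_image using w by (rule imageI)
      ultimately show "g \<in> word_value (weyl_group I A) ` lists (weyl_generators I A)"
        by blast
    qed
  qed
qed

lemma coxeter_relator_cases:
  assumes "r \<in> coxeter_relators I A"
  obtains i j m where "i \<in> I" "j \<in> I" "r = concat (replicate m [(i, True), (j, True)])"
    "i = j \<and> m = 1 \<or> i \<noteq> j \<and> coxeter_exponent A i j = enat m"
  using assms unfolding coxeter_relators_def by fastforce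

lemma (in group) word_value_concat_replicate:
  assumes "s \<in> carrier G" "t \<in> carrier G"
  shows "word_value G (concat (replicate m [s, t])) = (s \<otimes> t) [^] m"
proof (induction m)
  case (Suc m)
  then show ?case
    unfolding nat_pow_Suc2 [OF m_closed [OF assms]] using assms by (simp add: m_assoc)
qed simp

lemma exchange_weyl_group:
  assumes "finite I"
  shows "exchange_group (weyl_group I A) (weyl_generators I A)"
proof -
  interpret involution_generated_group "weyl_group I A" "weyl_generators I A"
    by (rule involution_generated_weyl_group)
  let ?G = "weyl_group I A" and ?S = "weyl_generators I A" and ?\<sigma> = "weyl_gen I A"
  have gen: "?\<sigma> ` I \<subseteq> ?S" by (simp add: weyl_generators_def)
  have relator: "ev (map (?\<sigma> \<circ> fst) r) = \<one>\<^bsub>?G\<^esub> \<and>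
      (\<forall>t\<in>carrier ?G. even (reflection_count (map (?\<sigma> \<circ> fst) r) t))"
    if r: "r \<in> coxeter_relators I A" for r
  proof -
    obtain i j m where ijm: "i \<in> I" "j \<in> I" "r = concat (replicate m [(i, True), (j, True)])"
      using r by (rule coxeter_relator_cases)
    have s: "?\<sigma> i \<in> ?S" "?\<sigma> j \<in> ?S" using ijm gen by auto
    have m: "map (?\<sigma> \<circ> fst) r = concat (replicate m [?\<sigma> i, ?\<sigma> j])"
      by (simp add: ijm(3) map_concat)
    have r_pos: "r = pos_word (concat (replicate m [i, j]))"
      by (simp add: ijm(3) map_concat pos_word_def)
    have w: "concat (replicate m [i, j]) \<in> lists I" using ijm(1,2) by (induction m) auto
    have rw: "r \<in> signed_words I" using w by (simp add: r_pos)
    have "ev (map (?\<sigma> \<circ> fst) r) = weyl_class I A r"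
      using word_value_weyl_gen [OF w] by (simp add: r_pos)
    also have "\<dots> = \<one>\<^bsub>?G\<^esub>"
      using pres_eq.relator [of "[]" I "[]" r "coxeter_relators I A"] r rw
      by (simp add: weyl_one weyl_class_eq_iff)
    finally have 1: "ev (map (?\<sigma> \<circ> fst) r) = \<one>\<^bsub>?G\<^esub>" .
    then have "(?\<sigma> i \<otimes>\<^bsub>?G\<^esub> ?\<sigma> j) [^]\<^bsub>?G\<^esub> m = \<one>\<^bsub>?G\<^esub>"
      using word_value_concat_replicate s by (simp add: m)
    then show ?thesis
      using 1 even_reflection_count_relator [OF s] by (simp add: m)
  qed
  have parity: "even (reflection_count xs t) \<longleftrightarrow> even (reflection_count ys t)"
    if words: "xs \<in> lists ?S" "ys \<in> lists ?S" "ev xs = ev ys" "t \<in> ?S" for xs ys t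
  proof -
    obtain ks js where ks: "ks \<in> lists I" "xs = map ?\<sigma> ks"
      and js: "js \<in> lists I" "ys = map ?\<sigma> js"
      using words(1,2) by (auto simp: weyl_generators_def lists_image)
    have "weyl_eq I A (pos_word ks) (pos_word js)"
      using words(3) ks js word_value_weyl_gen by (metis pos_word_signed_words weyl_class_eq_iff)
    then show ?thesis
      using pres_eq_reflection_parity [OF gen, of "coxeter_relators I A" "pos_word ks" "pos_word js"]
        relator words(4) ks(2) js(2) by simp
  qed
  show ?thesis
  proof
    show "finite ?S" using assms by (simp add: weyl_generators_def)
  qed (use exchange_of_reflection_parity parity in blast)
qed

lemma pres_eq_foldr:
  assumes inv: "\<And>i x. i \<in> I \<Longrightarrow> f i (f i x) = x"
    and rel: "\<And>r x. r \<in> R \<Longrightarrow> r \<in> signed_words I \<Longrightarrow> foldr (\<lambda>p. f (fst p)) r x = x"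
    and eq: "pres_eq I R u v"
  shows "foldr (\<lambda>p. f (fst p)) u x = foldr (\<lambda>p. f (fst p)) v x"
  using eq
proof (induction arbitrary: x rule: pres_eq.induct)
  case (cancel u v s b)
  then show ?case by (simp add: inv)
next
  case (relator u v r)
  then show ?case by (simp add: rel)
qed auto

section \<open>Distinct generators do not commute\<close>

text \<open>
  The two simple reflections of the root lattice of the rank 2 Cartan matrix with off-diagonal
  entries \<open>-1\<close> and \<open>-c\<close>, in coordinates with respect to the simple roots.
\<close>

definition rank2_reflection :: "int \<Rightarrow> bool \<Rightarrow> int \<times> int \<Rightarrow> int \<times> int" where
  "rank2_reflection c b = (\<lambda>(x, y). if b then (y - x, y) else (x, c * x - y))"

lemma rank2_reflection_involutive: "rank2_reflection c b (rank2_reflection c b z) = z"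
  by (cases z) (simp add: rank2_reflection_def)

lemma rank2_reflection_relator:
  assumes "(if c = 1 then m = 3 else if c = 2 then m = 4 else c = 3 \<and> m = 6)"
  shows "((rank2_reflection c b \<circ> rank2_reflection c b') ^^ m) z = z"
proof (cases "b = b'")
  case True
  then have "rank2_reflection c b \<circ> rank2_reflection c b' = id"
    by (simp add: rank2_reflection_involutive fun_eq_iff)
  then show ?thesis by simp
next
  case False
  obtain x y where "z = (x, y)" by fastforce
  then show ?thesis
    using assms False
    by (cases b) (auto simp: rank2_reflection_def eval_nat_numeral split: if_splits)
qed

lemma foldr_concat_replicate: "foldr f (concat (replicate m w)) = foldr f w ^^ m"
  by (induction m) (simp_all add: foldr_append)

text \<open>
  As all exponents are equal, sending \<open>i\<close> to the first rank 2 reflection and every other generator to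
  the second respects all relations, and the two reflections do not commute on the first simple
  root.
\<close>

lemma weyl_gens_not_commute:
  assumes uniform: "\<And>k l. k \<in> I \<Longrightarrow> l \<in> I \<Longrightarrow> k \<noteq> l \<Longrightarrow>
      coxeter_exponent A k l = coxeter_exponent A i j"
    and ij: "i \<in> I" "j \<in> I" "i \<noteq> j" "A i j * A j i > 0"
  shows "weyl_gen I A i \<otimes>\<^bsub>weyl_group I A\<^esub> weyl_gen I A j \<noteq>
    weyl_gen I A j \<otimes>\<^bsub>weyl_group I A\<^esub> weyl_gen I A i"
proof
  let ?c = "A i j * A j i"
  let ?f = "\<lambda>k. rank2_reflection ?c (k = i)"
  assume "weyl_gen I A i \<otimes>\<^bsub>weyl_group I A\<^esub> weyl_gen I A j =
    weyl_gen I A j \<otimes>\<^bsub>weyl_group I A\<^esub> weyl_gen I A i"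
  then have eq: "weyl_eq I A [(i, True), (j, True)] [(j, True), (i, True)]"
    using ij by (simp add: weyl_mult weyl_class_eq_iff)
  have rel: "foldr (\<lambda>p. ?f (fst p)) r z = z" if "r \<in> coxeter_relators I A" for r z
    using that
  proof (rule coxeter_relator_cases)
    fix k l m
    assume kl: "k \<in> I" "l \<in> I" "r = concat (replicate m [(k, True), (l, True)])"
      "k = l \<and> m = 1 \<or> k \<noteq> l \<and> coxeter_exponent A k l = enat m"
    have fold: "foldr (\<lambda>p. ?f (fst p)) r = (?f k \<circ> ?f l) ^^ m"
      by (simp add: kl(3) foldr_concat_replicate comp_def)
    show ?thesis
      using kl(4)
    proof
      assume "k = l \<and> m = 1"
      then show ?thesis by (simp add: fold rank2_reflection_involutive)
    next
      assume "k \<noteq> l \<and> coxeter_exponent A k l = enat m"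
      then have "coxeter_exponent A i j = enat m" using uniform kl by metis
      then have "if ?c = 1 then m = 3 else if ?c = 2 then m = 4 else ?c = 3 \<and> m = 6"
        using ij(4) by (auto simp: coxeter_exponent_def numeral_eq_enat split: if_splits)
      then show ?thesis unfolding fold by (rule rank2_reflection_relator)
    qed
  qed
  have "foldr (\<lambda>p. ?f (fst p)) [(i, True), (j, True)] (1, 0) =
      foldr (\<lambda>p. ?f (fst p)) [(j, True), (i, True)] (1, 0)"
    by (rule pres_eq_foldr [OF _ _ eq]) (simp_all add: rank2_reflection_involutive rel)
  then show False
    using ij(3,4) by (auto simp: rank2_reflection_def)
qed

lemma map_in_lists: "f ` I \<subseteq> J \<Longrightarrow> ks \<in> lists I \<Longrightarrow> map f ks \<in> lists J"
  by (induction ks) auto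

section \<open>Rank 2 parabolic subgroups\<close>

definition relabel :: "('i \<Rightarrow> 'j) \<Rightarrow> 'i signed_word \<Rightarrow> 'j signed_word" where
  "relabel f = map (\<lambda>(i, b). (f i, b))"

lemma relabel_simps [simp]:
  "relabel f [] = []" "relabel f (p # u) = (f (fst p), snd p) # relabel f u"
  "relabel f (u @ v) = relabel f u @ relabel f v"
  "relabel f (pos_word ks) = pos_word (map f ks)"
  by (auto simp: relabel_def pos_word_def split: prod.splits)

lemma relabel_signed_words: "f ` I \<subseteq> J \<Longrightarrow> u \<in> signed_words I \<Longrightarrow> relabel f u \<in> signed_words J"
  by (induction u) auto

text \<open>
  The map \<open>f\<close> may identify generators: then the relator of two identified generators becomes a
  power of a square.  This is what makes the retraction onto a parabolic subgroup possible.
\<close>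

lemma weyl_eq_relabel:
  assumes f: "f ` I \<subseteq> J"
    and uniform: "\<And>i j. i \<in> I \<Longrightarrow> j \<in> I \<Longrightarrow> f i \<noteq> f j \<Longrightarrow>
      coxeter_exponent B (f i) (f j) = coxeter_exponent A i j"
    and eq: "weyl_eq I A u v"
  shows "weyl_eq J B (relabel f u) (relabel f v)"
  using eq
proof (induction rule: pres_eq.induct)
  case (cancel u v s b)
  then show ?case
    using pres_eq.cancel [of "relabel f u" J "relabel f v" "f s" "coxeter_relators J B" b]
      relabel_signed_words [OF f] f by auto
next
  case (relator u v r)
  have rel: "weyl_eq J B (relabel f r) []"
    using relator(3)
  proof (rule coxeter_relator_cases)
    fix i j m
    assume ij: "i \<in> I" "j \<in> I" "r = concat (replicate m [(i, True), (j, True)])"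
      "i = j \<and> m = 1 \<or> i \<noteq> j \<and> coxeter_exponent A i j = enat m"
    have fij: "f i \<in> J" "f j \<in> J" using f ij by auto
    have fr: "relabel f r = concat (replicate m [(f i, True), (f j, True)])"
      by (simp add: ij(3) relabel_def map_concat)
    show ?thesis
    proof (cases "f i = f j")
      case True
      have "weyl_eq J B (concat (replicate k [(f i, True), (f i, True)])) []" for k
      proof (induction k)
        case (Suc k)
        then show ?case
          using pres_eq_append [OF weyl_eq_square [OF fij(1)] Suc] by simp
      qed (simp add: pres_eq.refl)
      then show ?thesis using True by (simp add: fr)
    next
      case False
      then have "relabel f r \<in> coxeter_relators J B"
        using ij(4) uniform [OF ij(1,2)] fij unfolding fr coxeter_relators_def by fastforce
      then show ?thesis
        using pres_eq.relator [of "[]" J "[]" "relabel f r" "coxeter_relators J B"]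
          relabel_signed_words [OF f relator(4)] by simp
    qed
  qed
  have "weyl_eq J B (relabel f u @ relabel f r @ relabel f v) (relabel f u @ [] @ relabel f v)"
    using relator relabel_signed_words [OF f]
    by (intro pres_eq_append rel pres_eq.refl)
  then show ?case by simp
next
  case (trans u v w)
  then show ?case by (blast intro: pres_eq.trans)
qed (use relabel_signed_words [OF f] in \<open>auto intro: pres_eq.refl pres_eq.sym\<close>)

lemma word_length_weyl_group:
  assumes u: "u \<in> signed_words I"
  shows "word_length (weyl_group I A) (weyl_generators I A) (weyl_class I A u) =
    (LEAST k. \<exists>ks\<in>lists I. length ks = k \<and> weyl_eq I A u (pos_word ks))"
proof -
  have "(\<exists>xs. set xs \<subseteq> weyl_generators I A \<and> length xs = k \<and>
        weyl_class I A u = word_value (weyl_group I A) xs) \<longleftrightarrow>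
      (\<exists>ks\<in>lists I. length ks = k \<and> weyl_eq I A u (pos_word ks))" for k
  proof -
    have "(\<exists>xs. set xs \<subseteq> weyl_generators I A \<and> length xs = k \<and>
          weyl_class I A u = word_value (weyl_group I A) xs) \<longleftrightarrow>
        (\<exists>xs\<in>lists (weyl_gen I A ` I). length xs = k \<and>
          weyl_class I A u = word_value (weyl_group I A) xs)"
      by (auto simp: weyl_generators_def lists_eq_set)
    also have "\<dots> \<longleftrightarrow> (\<exists>ks\<in>lists I. length ks = k \<and>
        weyl_class I A u = word_value (weyl_group I A) (map (weyl_gen I A) ks))"
      by (simp add: lists_image)
    also have "\<dots> \<longleftrightarrow> (\<exists>ks\<in>lists I. length ks = k \<and> weyl_eq I A u (pos_word ks))"
      by (rule bex_cong) (simp_all add: word_value_weyl_gen weyl_class_eq_iff [OF u] del: in_lists_conv_set)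
    finally show ?thesis .
  qed
  then show ?thesis
    by (simp add: word_length_def word_value_def)
qed

lemma card_image_eq_of_same_kernel:
  assumes "\<And>x y. x \<in> X \<Longrightarrow> y \<in> X \<Longrightarrow> f x = f y \<longleftrightarrow> g x = g y"
  shows "card (f ` X) = card (g ` X)"
proof (rule bij_betw_same_card)
  have fg: "g (inv_into X f (f x)) = g x" if "x \<in> X" for x
    using assms [of "inv_into X f (f x)" x] that by (simp add: inv_into_into f_inv_into_f)
  show "bij_betw (g \<circ> inv_into X f) (f ` X) (g ` X)"
    unfolding bij_betw_def inj_on_def using assms by (auto simp: fg image_image)
qed

lemma poincare_series_nth_0: "fps_nth (poincare_series I A) 0 = 1"
proof -
  interpret involution_generated_group "weyl_group I A" "weyl_generators I A"
    by (rule involution_generated_weyl_group)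
  have "{g \<in> carrier (weyl_group I A). len g = 0} = {\<one>\<^bsub>weyl_group I A\<^esub>}"
    by (auto simp: len_eq_0_iff)
  then show ?thesis by (simp add: poincare_series_def growth_series_def)
qed

text \<open>
  Relabelling along \<open>f\<close> maps the Weyl group of \<open>I\<close> onto the parabolic subgroup of \<open>J\<close>.  It has a left
  inverse that collapses all generators outside \<open>J\<close> to a single one; equality of all exponents makes
  this a homomorphism.  Both maps send generators to generators, so they preserve length.
\<close>

lemma poincare_series_eq_parabolic_length_series:
  assumes S: "finite S" and J: "J \<subseteq> S" "J \<noteq> {}" and f: "bij_betw f I J"
    and uniform: "\<And>i j k l. i \<in> S \<Longrightarrow> j \<in> S \<Longrightarrow> i \<noteq> j \<Longrightarrow> k \<in> S \<Longrightarrow> l \<in> S \<Longrightarrow> k \<noteq> l \<Longrightarrow>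
      coxeter_exponent A i j = coxeter_exponent A k l"
    and I: "I \<subseteq> S"
  shows "poincare_series I A =
    exchange_group.length_series (weyl_group S A) (weyl_generators S A)
      (exchange_group.parabolic (weyl_group S A) (weyl_gen S A ` J))"
proof -
  interpret exchange_group "weyl_group S A" "weyl_generators S A"
    by (rule exchange_weyl_group [OF S])
  have fI: "f ` I = J" and inj: "inj_on f I"
    using f by (simp_all add: bij_betw_def)
  have fS: "f ` I \<subseteq> S" using fI J by simp
  obtain i0 where i0: "i0 \<in> I" using fI J(2) by auto
  define g where "g k = (if k \<in> J then inv_into I f k else i0)" for k
  have gI: "g ` S \<subseteq> I" using fI i0 by (auto simp: g_def inv_into_into)
  have gf: "g (f i) = i" if "i \<in> I" for i
    using that fI inj by (auto simp: g_def)
  have "relabel g (relabel f u) = u" if "u \<in> signed_words I" for u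
    using that by (induction u) (auto simp: gf)
  note rgf = this
  have to: "weyl_eq S A (relabel f u) (relabel f v)" if "weyl_eq I A u v" for u v
  proof (rule weyl_eq_relabel [OF fS _ that])
    show "coxeter_exponent A (f i) (f j) = coxeter_exponent A i j"
      if "i \<in> I" "j \<in> I" "f i \<noteq> f j" for i j
      by (rule uniform) (use that fS I in auto)
  qed
  have fro: "weyl_eq I A (relabel g u) (relabel g v)" if "weyl_eq S A u v" for u v
  proof (rule weyl_eq_relabel [OF gI _ that])
    show "coxeter_exponent A (g i) (g j) = coxeter_exponent A i j"
      if "i \<in> S" "j \<in> S" "g i \<noteq> g j" for i j
      by (rule uniform) (use that gI I in auto)
  qed
  have iff: "weyl_eq S A (relabel f u) (relabel f v) \<longleftrightarrow> weyl_eq I A u v"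
    if "u \<in> signed_words I" "v \<in> signed_words I" for u v
    using to [of u v] fro [of "relabel f u" "relabel f v"] that by (auto simp: rgf)
  have length: "len (weyl_class S A (relabel f u)) =
      word_length (weyl_group I A) (weyl_generators I A) (weyl_class I A u)"
    if u: "u \<in> signed_words I" for u
  proof -
    have "(\<exists>ks\<in>lists S. length ks = k \<and> weyl_eq S A (relabel f u) (pos_word ks)) \<longleftrightarrow>
        (\<exists>ks\<in>lists I. length ks = k \<and> weyl_eq I A u (pos_word ks))" for k
    proof
      assume "\<exists>ks\<in>lists S. length ks = k \<and> weyl_eq S A (relabel f u) (pos_word ks)"
      then obtain ks where ks: "ks \<in> lists S" "length ks = k"
        "weyl_eq S A (relabel f u) (pos_word ks)" by blast
      have "weyl_eq I A u (pos_word (map g ks))" using fro [OF ks(3)] rgf [OF u] by simp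
      moreover have "map g ks \<in> lists I" using map_in_lists [OF gI ks(1)] .
      ultimately show "\<exists>ks\<in>lists I. length ks = k \<and> weyl_eq I A u (pos_word ks)"
        using ks(2) by (metis length_map)
    next
      assume "\<exists>ks\<in>lists I. length ks = k \<and> weyl_eq I A u (pos_word ks)"
      then obtain ks where ks: "ks \<in> lists I" "length ks = k"
        "weyl_eq I A u (pos_word ks)" by blast
      have "weyl_eq S A (relabel f u) (pos_word (map f ks))" using to [OF ks(3)] by simp
      moreover have "map f ks \<in> lists S" using map_in_lists [OF fS ks(1)] .
      ultimately show "\<exists>ks\<in>lists S. length ks = k \<and> weyl_eq S A (relabel f u) (pos_word ks)"
        using ks(2) by (metis length_map)
    qed
    then show ?thesis
      by (simp add: word_length_weyl_group u relabel_signed_words [OF fS])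
  qed
  have parabolic: "parabolic (weyl_gen S A ` J) = (\<lambda>u. weyl_class S A (relabel f u)) ` signed_words I"
  proof -
    have "parabolic (weyl_gen S A ` J) =
        (\<lambda>ks. word_value (weyl_group S A) (map (weyl_gen S A) (map f ks))) ` lists I"
      unfolding parabolic_def fI [symmetric] lists_image image_image by (simp add: comp_def)
    also have "\<dots> = (\<lambda>ks. weyl_class S A (relabel f (pos_word ks))) ` lists I"
    proof (rule image_cong [OF HOL.refl])
      fix ks assume "ks \<in> lists I"
      then have "map f ks \<in> lists S" by (rule map_in_lists [OF fS])
      then show "word_value (weyl_group S A) (map (weyl_gen S A) (map f ks)) =
          weyl_class S A (relabel f (pos_word ks))"
        by (subst word_value_weyl_gen) simp_all
    qed
    also have "\<dots> = (\<lambda>u. weyl_class S A (relabel f u)) ` signed_words I"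
    proof (intro equalityI subsetI)
      fix x assume "x \<in> (\<lambda>u. weyl_class S A (relabel f u)) ` signed_words I"
      then obtain u where u: "u \<in> signed_words I" "x = weyl_class S A (relabel f u)" by auto
      have w: "map fst u \<in> lists I" using u(1) by (rule map_fst_signed_words)
      have "x = weyl_class S A (relabel f (pos_word (map fst u)))"
        using to [OF weyl_eq_pos_word [OF u(1)]] u relabel_signed_words [OF fS u(1)]
        by (simp add: weyl_class_eq_iff)
      then show "x \<in> (\<lambda>ks. weyl_class S A (relabel f (pos_word ks))) ` lists I"
        using w by blast
    qed (auto simp del: relabel_simps in_lists_conv_set)
    finally show ?thesis .
  qed
  have "card {x \<in> carrier (weyl_group I A).
        word_length (weyl_group I A) (weyl_generators I A) x = k} =
      card {x \<in> parabolic (weyl_gen S A ` J). len x = k}" for k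
  proof -
    let ?U = "{u \<in> signed_words I.
      word_length (weyl_group I A) (weyl_generators I A) (weyl_class I A u) = k}"
    have 1: "{x \<in> carrier (weyl_group I A).
        word_length (weyl_group I A) (weyl_generators I A) x = k} = weyl_class I A ` ?U"
      by (auto simp: carrier_weyl_group)
    have 2: "{x \<in> parabolic (weyl_gen S A ` J). len x = k} =
        (\<lambda>u. weyl_class S A (relabel f u)) ` ?U"
      by (auto simp: parabolic length)
    have "weyl_class I A u = weyl_class I A v \<longleftrightarrow>
        weyl_class S A (relabel f u) = weyl_class S A (relabel f v)" if "u \<in> ?U" "v \<in> ?U" for u v
      using that iff [of u v] by (simp add: weyl_class_eq_iff relabel_signed_words [OF fS])
    then show ?thesis unfolding 1 2 by (rule card_image_eq_of_same_kernel)
  qed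
  then show ?thesis
    by (simp add: poincare_series_def growth_series_def length_series_def)
qed

section \<open>The Poincare series for constant rank 2 type\<close>

lemma same_rank2_type_exponent:
  assumes "same_rank2_type S A" "i \<in> S" "j \<in> S" "i \<noteq> j" "k \<in> S" "l \<in> S" "k \<noteq> l"
  shows "coxeter_exponent A i j = coxeter_exponent A k l"
proof -
  obtain C where C: "C \<in> rank2_classes" "A i j * A j i \<in> C" "A k l * A l k \<in> C"
    using assms unfolding same_rank2_type_def by blast
  then show ?thesis by (auto simp: rank2_classes_def coxeter_exponent_def)
qed

theorem theorem1:
  fixes n :: nat and A :: "nat \<Rightarrow> nat \<Rightarrow> int" and I :: "nat set" and P\<^sub>n P\<^sub>2 :: "rat fps"
  assumes "cartan_matrix {1..n} A"
    and "same_rank2_type {1..n} A"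
    and "n \<ge> 3 \<longrightarrow> (\<forall>i\<in>{1..n}. \<forall>j\<in>{1..n}. i \<noteq> j \<longrightarrow> A i j * A j i \<noteq> 0)"
    and "I \<subseteq> {1..n}" "card I = 2"
    and "P\<^sub>n = poincare_series {1..n} A"
    and "P\<^sub>2 = poincare_series I A"
  shows "P\<^sub>n = (1 + fps_X) * P\<^sub>2 /
    (fps_const ((of_nat n - 1) * (of_nat n - 2) / 2) * fps_X * P\<^sub>2
     - fps_const ((of_nat n + 1) * (of_nat n - 2) / 2) * P\<^sub>2
     + fps_const (of_nat n * (of_nat n - 1) / 2) * (1 + fps_X))"
    (is "_ = ?N / ?D")
proof -
  let ?S = "{1..n}"
  let ?G = "weyl_group ?S A" and ?gens = "weyl_generators ?S A"
  interpret exchange_group ?G ?gens by (rule exchange_weyl_group) simp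
  have "fps_nth ?N 0 = 1" by (simp add: assms(7) poincare_series_nth_0)
  then have "?N \<noteq> 0" by (metis fps_zero_nth zero_neq_one)
  have "n \<ge> 2" using card_mono [OF _ assms(4)] assms(5) by simp
  have product: "P\<^sub>n * ?D = ?N"
  proof (cases "n = 2")
    case True
    then have "I = ?S" using assms(4,5) by (intro card_subset_eq) auto
    then show ?thesis using True assms(6,7) by (simp add: mult.commute)
  next
    case False
    then have n3: "n \<ge> 3" using \<open>n \<ge> 2\<close> by simp
    have pos: "A i j * A j i > 0" if "i \<in> ?S" "j \<in> ?S" "i \<noteq> j" for i j
    proof -
      have "A i j \<le> 0" "A j i \<le> 0" using assms(1) that by (auto simp: cartan_matrix_def)
      then have "A i j * A j i \<ge> 0" by (rule mult_nonpos_nonpos)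
      moreover have "A i j * A j i \<noteq> 0" using assms(3) n3 that by blast
      ultimately show ?thesis by linarith
    qed
    note uniform = same_rank2_type_exponent [OF assms(2)]
    have comm: "weyl_gen ?S A i \<otimes>\<^bsub>?G\<^esub> weyl_gen ?S A j \<noteq> weyl_gen ?S A j \<otimes>\<^bsub>?G\<^esub> weyl_gen ?S A i"
      if "i \<in> ?S" "j \<in> ?S" "i \<noteq> j" for i j
      using weyl_gens_not_commute [OF uniform [OF _ _ _ that] that pos [OF that]] .
    have inj: "inj_on (weyl_gen ?S A) ?S"
      using comm by (intro inj_onI) metis
    have card: "card ?gens = n"
      using card_image [OF inj] by (simp add: weyl_generators_def)
    have rank2: "length_series (parabolic J) = P\<^sub>2" if J: "J \<subseteq> ?gens" "card J = 2" for J
    proof -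
      obtain J' where J': "J' \<subseteq> ?S" "J = weyl_gen ?S A ` J'"
        using J(1) by (auto simp: weyl_generators_def subset_image_iff)
      have "card J' = 2" using card_image [OF inj_on_subset [OF inj J'(1)]] J' J(2) by simp
      moreover have "finite J'" "finite I" using J'(1) assms(4) finite_subset by blast+
      ultimately obtain f where "bij_betw f I J'"
        using finite_same_card_bij assms(5) by metis
      then have "poincare_series I A = length_series (parabolic (weyl_gen ?S A ` J'))"
        using \<open>card J' = 2\<close> assms(4) J'(1)
        by (intro poincare_series_eq_parabolic_length_series) (auto intro: uniform)
      then show ?thesis using assms(7) J'(2) by simp
    qed
    have noncomm: "x \<otimes>\<^bsub>?G\<^esub> y \<noteq> y \<otimes>\<^bsub>?G\<^esub> x" if xy: "x \<in> ?gens" "y \<in> ?gens" "x \<noteq> y" for x y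
    proof -
      obtain i j where ij: "i \<in> ?S" "x = weyl_gen ?S A i" "j \<in> ?S" "y = weyl_gen ?S A j"
        using xy(1,2) unfolding weyl_generators_def by blast
      then have "i \<noteq> j" using xy(3) by blast
      then show ?thesis unfolding ij(2,4) by (rule comm [OF ij(1,3)])
    qed
    show ?thesis
      using growth_series_formula [OF noncomm rank2]
      unfolding card assms(6) poincare_series_def [of ?S] .
  qed
  \<comment> \<open>The numerator has constant term 1, so the denominator is nonzero and can be cancelled.\<close>
  then have "?D \<noteq> 0" using \<open>?N \<noteq> 0\<close> by auto
  then show ?thesis unfolding product [symmetric] by (rule nonzero_mult_div_cancel_right [symmetric])
qed

end
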